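(* Let $d,k,p$ be integers with $1\le k<d$ and $1\le p<d$, let $V=\mathbb{C}^d$ with basis $\{x_1,\dots,x_d\}$, and let $P=x_1\cdots x_d\in S^dV$. The map $$P_{k,d-k}^{\wedge p}:S^kV^*\otimes\Lambda^pV\rightarrow S^{d-k-1}V\otimes\Lambda^{p+1}V$$ has rank $$\mathbf{S}(p,d,k)=\sum_{s=\max\{0,p-k\}}^{\min\{p,d-k-1\}}\binom{d}{s}\binom{d-s}{d-k+p-2s}\binom{d-k+p-2s-1}{p-s}=\frac{d!}{p!(d-p-1)!}\sum_{s=\max\{0,p-k\}}^{\min\{p,d-k-1\}}\frac{\binom{p}{s}\binom{d-1-p}{s+k-p}}{d-k+p-2s}.$$ In particular, when $d\ge 6$ and $\lceil d/2\rceil\le k\le d-3$, the $(\mathbf{S}(p,d,k)+1)\times(\mathbf{S}(p,d,k)+1)$ minors of the Koszul Young flattening $Q\mapsto Q_{k,d-k}^{\wedge p}$ ($Q\in S^dV$), regarded as polynomials on $S^dV$, are in the ideal of the Chow variety $Ch_d(V)$.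
   Context: $V$ is a finite-dimensional complex vector space, $S^jV$ and $\Lambda^jV$ are its symmetric and exterior powers. For $P\in S^dV$ and $1\le k<d$, the flattening $P_{k,d-k}:S^kV^*\to S^{d-k}V$ is the linear map sending a homogeneous degree-$k$ constant-coefficient differential operator $D\in S^kV^*$ to $D(P)$, i.e. $\frac{\partial^k}{\partial x_1^{i_1}\cdots\partial x_n^{i_n}}\mapsto\frac{\partial^kP}{\partial x_1^{i_1}\cdots\partial x_n^{i_n}}$ for a basis $x_1,\dots,x_n$ of $V$. The Koszul Young flattening $P_{k,d-k}^{\wedge p}:S^kV^*\otimes\Lambda^pV\to S^{d-k-1}V\otimes\Lambda^{p+1}V$ is the composition of $P_{k,d-k}\otimes\mathrm{Id}_{\Lambda^pV}:S^kV^*\otimes\Lambda^pV\to S^{d-k}V\otimes\Lambda^pV$ with the exterior derivative $\wedge_{d-k,p}:S^{d-k}V\otimes\Lambda^pV\to S^{d-k-1}V\otimes\Lambda^{p+1}V$, the linear map given by $l_1\cdots l_{d-k}\otimes m_1\wedge\cdots\wedge m_p\mapsto\sum_{s=1}^{d-k}l_1\cdots\hat{l_s}\cdots l_{d-k}\otimes l_s\wedge m_1\wedge\cdots\wedge m_p$. The Chow variety is $Ch_d(V)=\mathbb{P}\{z\in S^dV\mid z=w_1\cdots w_d\text{ for some }w_i\in V\}\subset\mathbb{P}S^dV$. Since $Q\mapsto Q_{k,d-k}^{\wedge p}$ is linear in $Q$, the minors of its matrix (in fixed bases) are homogeneous polynomials on $S^dV$. *)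

theory Defs
  imports Complex_Main "HOL-Library.Poly_Mapping" "Jordan_Normal_Form.Determinant"
begin

section \<open>Complex vector spaces with a distinguished basis\<close>

text \<open>All spaces below live inside some \<^typ>\<open>'b \<Rightarrow>\<^sub>0 complex\<close>, the complex vector space of
  finitely supported functions on a set of basis labels.\<close>

definition cscale :: "complex \<Rightarrow> ('b \<Rightarrow>\<^sub>0 complex) \<Rightarrow> ('b \<Rightarrow>\<^sub>0 complex)" where
  "cscale c v = Poly_Mapping.map ((*) c) v"

lemma lookup_cscale [simp]: "Poly_Mapping.lookup (cscale c v) b = c * Poly_Mapping.lookup v b"
  by (simp add: cscale_def Poly_Mapping.map.rep_eq when_def)

interpretation cvs: vector_space cscale
  by unfold_locales (auto intro!: poly_mapping_eqI simp: lookup_add algebra_simps)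

definition basis_vec :: "'b \<Rightarrow> ('b \<Rightarrow>\<^sub>0 complex)" where
  "basis_vec b = Poly_Mapping.single b 1"

definition lin_ext :: "('b \<Rightarrow> ('c \<Rightarrow>\<^sub>0 complex)) \<Rightarrow> ('b \<Rightarrow>\<^sub>0 complex) \<Rightarrow> ('c \<Rightarrow>\<^sub>0 complex)" where
  "lin_ext f v = (\<Sum>b\<in>Poly_Mapping.keys v. cscale (Poly_Mapping.lookup v b) (f b))"

text \<open>The rank of a linear map restricted to the subspace \<open>W\<close>.\<close>

definition rank_on :: "('b \<Rightarrow>\<^sub>0 complex) set \<Rightarrow> (('b \<Rightarrow>\<^sub>0 complex) \<Rightarrow> ('c \<Rightarrow>\<^sub>0 complex)) \<Rightarrow> nat" where
  "rank_on W f = cvs.dim (f ` W)"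

text \<open>The tensor product of the spaces with bases \<open>'b\<close> and \<open>'c\<close> has basis \<open>'b \<times> 'c\<close>.\<close>

definition tensor :: "('b \<Rightarrow>\<^sub>0 complex) \<Rightarrow> ('c \<Rightarrow>\<^sub>0 complex) \<Rightarrow> ('b \<times> 'c \<Rightarrow>\<^sub>0 complex)" where
  "tensor v w = lin_ext (\<lambda>b. lin_ext (\<lambda>c. basis_vec (b, c)) w) v"

definition tensor_space ::
    "('b \<Rightarrow>\<^sub>0 complex) set \<Rightarrow> ('c \<Rightarrow>\<^sub>0 complex) set \<Rightarrow> ('b \<times> 'c \<Rightarrow>\<^sub>0 complex) set" where
  "tensor_space A B = cvs.span {tensor v w | v w. v \<in> A \<and> w \<in> B}"

definition tensor_map ::
    "(('b \<Rightarrow>\<^sub>0 complex) \<Rightarrow> ('d \<Rightarrow>\<^sub>0 complex)) \<Rightarrow> (('c \<Rightarrow>\<^sub>0 complex) \<Rightarrow> ('e \<Rightarrow>\<^sub>0 complex))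
      \<Rightarrow> ('b \<times> 'c \<Rightarrow>\<^sub>0 complex) \<Rightarrow> ('d \<times> 'e \<Rightarrow>\<^sub>0 complex)" where
  "tensor_map f g = lin_ext (\<lambda>(b, c). tensor (f (basis_vec b)) (g (basis_vec c)))"


section \<open>Symmetric and exterior powers\<close>

text \<open>\<open>V\<close> is the \<open>n\<close>-dimensional space with basis \<open>x\<^sub>1, \<dots>, x\<^sub>n\<close>, the vector \<open>x\<^sub>i\<close> being
  \<^term>\<open>basis_vec (i::nat)\<close>.\<close>

definition base_space :: "nat \<Rightarrow> (nat \<Rightarrow>\<^sub>0 complex) set" where
  "base_space n = {v. Poly_Mapping.keys v \<subseteq> {1..n}}"

text \<open>A polynomial in the \<open>x\<^sub>i\<close> is a combination of exponent vectors; multiplication of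
  polynomials is the convolution product that comes with \<^theory>\<open>HOL-Library.Poly_Mapping\<close>.\<close>

type_synonym expo = "nat \<Rightarrow>\<^sub>0 nat"
type_synonym mpoly = "expo \<Rightarrow>\<^sub>0 complex"

definition sym_power :: "nat \<Rightarrow> nat \<Rightarrow> mpoly set" where
  "sym_power n j = {Q. \<forall>a\<in>Poly_Mapping.keys Q. Poly_Mapping.keys a \<subseteq> {1..n} \<and>
     (\<Sum>i\<in>Poly_Mapping.keys a. Poly_Mapping.lookup a i) = j}"

definition lin_form :: "(nat \<Rightarrow>\<^sub>0 complex) \<Rightarrow> mpoly" where
  "lin_form = lin_ext (\<lambda>i. basis_vec (Poly_Mapping.single i 1))"

text \<open>The label \<open>{i\<^sub>1 < \<dots> < i\<^sub>p}\<close> stands for the basis vector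
  \<open>x\<^bsub>i\<^sub>1\<^esub> \<and> \<dots> \<and> x\<^bsub>i\<^sub>p\<^esub>\<close> of the exterior algebra.\<close>

type_synonym ext = "nat set \<Rightarrow>\<^sub>0 complex"

definition ext_power :: "nat \<Rightarrow> nat \<Rightarrow> ext set" where
  "ext_power n p = {\<omega>. \<forall>I\<in>Poly_Mapping.keys \<omega>. I \<subseteq> {1..n} \<and> card I = p}"

definition wedge_basis :: "nat \<Rightarrow> nat set \<Rightarrow> ext" where
  "wedge_basis i I =
     (if i \<in> I then 0 else cscale ((-1) ^ card {j\<in>I. j < i}) (basis_vec (insert i I)))"

definition wedge :: "(nat \<Rightarrow>\<^sub>0 complex) \<Rightarrow> ext \<Rightarrow> ext" where
  "wedge v \<omega> = lin_ext (\<lambda>i. lin_ext (wedge_basis i) \<omega>) v"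


section \<open>Koszul Young flattenings\<close>

definition partial :: "nat \<Rightarrow> mpoly \<Rightarrow> mpoly" where
  "partial i = lin_ext (\<lambda>a. cscale (of_nat (Poly_Mapping.lookup a i))
     (basis_vec (a - Poly_Mapping.single i 1)))"

definition partials :: "expo \<Rightarrow> mpoly \<Rightarrow> mpoly" where
  "partials a = fold (\<lambda>i. partial i ^^ Poly_Mapping.lookup a i)
     (sorted_list_of_set (Poly_Mapping.keys a))"

text \<open>An element of \<open>S\<^sup>kV\<^sup>*\<close> is again a polynomial, now in the symbols \<open>\<partial>/\<partial>x\<^sub>i\<close>: the exponent
  vector \<open>a\<close> stands for the operator \<^term>\<open>partials a\<close>. The degrees \<open>k\<close> and \<open>p\<close> enter only
  through the domain on which the following maps are considered.\<close>

definition flattening :: "mpoly \<Rightarrow> mpoly \<Rightarrow> mpoly" where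
  "flattening P = lin_ext (\<lambda>a. partials a P)"

definition ext_deriv :: "(expo \<times> nat set \<Rightarrow>\<^sub>0 complex) \<Rightarrow> (expo \<times> nat set \<Rightarrow>\<^sub>0 complex)" where
  "ext_deriv = lin_ext (\<lambda>(a, I).
     \<Sum>i\<in>Poly_Mapping.keys a. tensor (partial i (basis_vec a)) (wedge_basis i I))"

definition koszul_flattening ::
    "mpoly \<Rightarrow> (expo \<times> nat set \<Rightarrow>\<^sub>0 complex) \<Rightarrow> (expo \<times> nat set \<Rightarrow>\<^sub>0 complex)" where
  "koszul_flattening P = ext_deriv \<circ> tensor_map (flattening P) id"

definition koszul_dom :: "nat \<Rightarrow> nat \<Rightarrow> nat \<Rightarrow> (expo \<times> nat set \<Rightarrow>\<^sub>0 complex) set" where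
  "koszul_dom n k p = tensor_space (sym_power n k) (ext_power n p)"

definition koszul_cod :: "nat \<Rightarrow> nat \<Rightarrow> nat \<Rightarrow> nat \<Rightarrow> (expo \<times> nat set \<Rightarrow>\<^sub>0 complex) set" where
  "koszul_cod n d k p = tensor_space (sym_power n (d - k - 1)) (ext_power n (p + 1))"

definition is_basis_of :: "('b \<Rightarrow>\<^sub>0 complex) set \<Rightarrow> ('b \<Rightarrow>\<^sub>0 complex) set \<Rightarrow> bool" where
  "is_basis_of B W \<longleftrightarrow> cvs.independent B \<and> cvs.span B = W"

text \<open>The minor with columns \<open>bs\<close> (vectors of the domain) and rows \<open>cs\<close> (elements of the basis
  \<open>C\<close> of the codomain) of the matrix of the Koszul Young flattening of \<open>Q\<close>.\<close>

definition koszul_minor ::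
    "(expo \<times> nat set \<Rightarrow>\<^sub>0 complex) set \<Rightarrow> (expo \<times> nat set \<Rightarrow>\<^sub>0 complex) list
      \<Rightarrow> (expo \<times> nat set \<Rightarrow>\<^sub>0 complex) list \<Rightarrow> mpoly \<Rightarrow> complex" where
  "koszul_minor C bs cs Q = det (mat (length cs) (length bs)
     (\<lambda>(i, j). cvs.representation C (koszul_flattening Q (bs ! j)) (cs ! i)))"


section \<open>Ideals of projective varieties and the Chow variety\<close>

text \<open>Polynomial functions on the vector space \<open>W\<close>; only the values on \<open>W\<close> matter.\<close>

inductive poly_fun :: "('b \<Rightarrow>\<^sub>0 complex) set \<Rightarrow> (('b \<Rightarrow>\<^sub>0 complex) \<Rightarrow> complex) \<Rightarrow> bool"
  for W where
  linear: "(\<And>v w. v \<in> W \<Longrightarrow> w \<in> W \<Longrightarrow> f (v + w) = f v + f w) \<Longrightarrow>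
    (\<And>c v. v \<in> W \<Longrightarrow> f (cscale c v) = c * f v) \<Longrightarrow> poly_fun W f"
| const: "poly_fun W (\<lambda>_. c)"
| add: "poly_fun W f \<Longrightarrow> poly_fun W g \<Longrightarrow> poly_fun W (\<lambda>v. f v + g v)"
| mult: "poly_fun W f \<Longrightarrow> poly_fun W g \<Longrightarrow> poly_fun W (\<lambda>v. f v * g v)"

text \<open>Points of projective space are lines through the origin.\<close>

definition projectivize :: "('b \<Rightarrow>\<^sub>0 complex) set \<Rightarrow> ('b \<Rightarrow>\<^sub>0 complex) set set" where
  "projectivize Z = {cvs.span {z} | z. z \<in> Z \<and> z \<noteq> 0}"

definition chow_variety :: "nat \<Rightarrow> nat \<Rightarrow> mpoly set set" where
  "chow_variety n d = projectivize {z \<in> sym_power n d.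
     \<exists>w. (\<forall>i\<in>{1..d}. w i \<in> base_space n) \<and> z = (\<Prod>i=1..d. lin_form (w i))}"

text \<open>Vanishing at a point of projective space means vanishing at every nonzero vector of the
  line, so this is the homogeneous ideal.\<close>

definition ideal_of ::
    "('b \<Rightarrow>\<^sub>0 complex) set \<Rightarrow> ('b \<Rightarrow>\<^sub>0 complex) set set \<Rightarrow> (('b \<Rightarrow>\<^sub>0 complex) \<Rightarrow> complex) set" where
  "ideal_of W X = {f. poly_fun W f \<and> (\<forall>L\<in>X. \<forall>z\<in>L - {0}. f z = 0)}"


section \<open>The rank formula\<close>

definition S_rank :: "nat \<Rightarrow> nat \<Rightarrow> nat \<Rightarrow> nat" where
  "S_rank p d k = (\<Sum>s = max 0 (p - k)..min p (d - k - 1).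
     (d choose s) * ((d - s) choose (d - k + p - 2 * s)) *
     ((d - k + p - 2 * s - 1) choose (p - s)))"


section \<open>Agreement with the coordinate-free descriptions\<close>

lemma lin_ext_superset:
  assumes "finite S" "Poly_Mapping.keys v \<subseteq> S"
  shows "lin_ext f v = (\<Sum>b\<in>S. cscale (Poly_Mapping.lookup v b) (f b))"
  unfolding lin_ext_def
  by (rule sum.mono_neutral_left) (use assms in \<open>auto simp: in_keys_iff\<close>)

lemma lin_ext_add: "lin_ext f (v + w) = lin_ext f v + lin_ext f w"
proof -
  let ?S = "Poly_Mapping.keys v \<union> Poly_Mapping.keys w"
  have "Poly_Mapping.keys (v + w) \<subseteq> ?S" by (rule Poly_Mapping.keys_add)
  then show ?thesis
    by (simp add: lin_ext_superset[where S = ?S] lookup_add cvs.scale_left_distrib sum.distrib)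
qed

lemma lin_ext_cscale: "lin_ext f (cscale c v) = cscale c (lin_ext f v)"
proof -
  have "Poly_Mapping.keys (cscale c v) \<subseteq> Poly_Mapping.keys v" by (auto simp: in_keys_iff)
  then show ?thesis
    by (simp add: lin_ext_superset[where S = "Poly_Mapping.keys v"] cvs.scale_sum_right)
qed

lemma lin_ext_basis_vec [simp]: "lin_ext f (basis_vec b) = f b"
  by (simp add: lin_ext_def basis_vec_def)

lemma linear_lin_ext: "Vector_Spaces.linear cscale cscale (lin_ext f)"
  by unfold_locales (simp_all add: lin_ext_add lin_ext_cscale)

lemma lin_ext_sum: "lin_ext f (\<Sum>x\<in>A. g x) = (\<Sum>x\<in>A. lin_ext f (g x))"
  by (rule module_hom.sum[OF linear_lin_ext[unfolded linear_iff_module_hom]])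

lemma lin_ext_zero [simp]: "lin_ext f 0 = 0"
  by (simp add: lin_ext_def)

lemma expand_basis: "v = (\<Sum>b\<in>Poly_Mapping.keys v. cscale (Poly_Mapping.lookup v b) (basis_vec b))"
proof (rule poly_mapping_eqI)
  fix k
  have "(\<Sum>b\<in>Poly_Mapping.keys v. Poly_Mapping.lookup v b * (if b = k then 1 else 0)) = Poly_Mapping.lookup v k"
    by (simp add: if_distrib sum.delta in_keys_iff cong: if_cong)
  then show "Poly_Mapping.lookup v k = Poly_Mapping.lookup
      (\<Sum>b\<in>Poly_Mapping.keys v. cscale (Poly_Mapping.lookup v b) (basis_vec b)) k"
    by (simp add: lookup_sum basis_vec_def lookup_single when_def)
qed

lemma lin_ext_unique:
  assumes "Vector_Spaces.linear cscale cscale f"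
  shows "f v = lin_ext (\<lambda>b. f (basis_vec b)) v"
proof -
  interpret f: Vector_Spaces.linear cscale cscale f by (rule assms)
  show ?thesis
    by (subst (1) expand_basis) (simp add: f.sum f.scale lin_ext_def)
qed

lemma lookup_tensor [simp]:
  "Poly_Mapping.lookup (tensor v w) (b, c) = Poly_Mapping.lookup v b * Poly_Mapping.lookup w c"
proof -
  have w: "Poly_Mapping.lookup (lin_ext (\<lambda>c. basis_vec (b', c)) w) (b, c) =
      (if b' = b then Poly_Mapping.lookup w c else 0)" for b'
    by (simp add: lin_ext_def lookup_sum basis_vec_def lookup_single when_def if_distrib
        sum.delta in_keys_iff cong: if_cong)
  show ?thesis
    unfolding tensor_def
    by (subst lin_ext_def)
       (simp add: lookup_sum w if_distrib sum.delta in_keys_iff cong: if_cong)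
qed

lemma tensor_add_left: "tensor (v + v') w = tensor v w + tensor v' w"
  and tensor_add_right: "tensor v (w + w') = tensor v w + tensor v w'"
  and tensor_cscale_left: "tensor (cscale c v) w = cscale c (tensor v w)"
  and tensor_cscale_right: "tensor v (cscale c w) = cscale c (tensor v w)"
  by (auto intro!: poly_mapping_eqI simp: lookup_add algebra_simps)

lemma tensor_sum_left: "tensor (\<Sum>x\<in>A. g x) w = (\<Sum>x\<in>A. tensor (g x) w)"
  and tensor_sum_right: "tensor w (\<Sum>x\<in>A. h x) = (\<Sum>x\<in>A. tensor w (h x))"
  by (auto intro!: poly_mapping_eqI simp: lookup_sum sum_distrib_left sum_distrib_right)

lemma tensor_basis_vec: "tensor (basis_vec b) (basis_vec c) = basis_vec (b, c)"
  by (simp add: tensor_def)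

lemma tensor_map_tensor:
  assumes "Vector_Spaces.linear cscale cscale f" "Vector_Spaces.linear cscale cscale g"
  shows "tensor_map f g (tensor v w) = tensor (f v) (g w)"
proof -
  interpret f: Vector_Spaces.linear cscale cscale f by fact
  interpret g: Vector_Spaces.linear cscale cscale g by fact
  have "tensor_map f g (tensor v w) =
     (\<Sum>b\<in>Poly_Mapping.keys v. \<Sum>c\<in>Poly_Mapping.keys w.
        cscale (Poly_Mapping.lookup v b) (cscale (Poly_Mapping.lookup w c)
          (tensor (f (basis_vec b)) (g (basis_vec c)))))"
    unfolding tensor_def tensor_map_def
    by (subst lin_ext_def[of _ v], subst lin_ext_def[of _ w])
       (simp add: lin_ext_sum lin_ext_cscale cvs.scale_sum_right tensor_def)
  also have "\<dots> = tensor (f v) (g w)"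
    by (subst (3) expand_basis[of v], subst (3) expand_basis[of w])
       (simp add: f.sum f.scale g.sum g.scale tensor_sum_left tensor_sum_right
          tensor_cscale_left tensor_cscale_right cvs.scale_sum_right,
        subst sum.swap, simp add: mult.commute)
  finally show ?thesis .
qed

lemma wedge_basis_vec: "wedge (basis_vec i) (basis_vec I) = wedge_basis i I"
  by (simp add: wedge_def)

lemma wedge_add_left: "wedge (v + v') w = wedge v w + wedge v' w"
  and wedge_cscale_left: "wedge (cscale c v) w = cscale c (wedge v w)"
  by (simp_all add: wedge_def lin_ext_add lin_ext_cscale)

lemma wedge_add_right: "wedge v (w + w') = wedge v w + wedge v w'"
  by (simp add: wedge_def lin_ext_def[of _ v] lin_ext_add cvs.scale_right_distrib sum.distrib)

lemma wedge_cscale_right: "wedge v (cscale c w) = cscale c (wedge v w)"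
  by (simp add: wedge_def lin_ext_def[of _ v] lin_ext_cscale cvs.scale_sum_right mult.commute)

lemma wedge_sum_left: "wedge (\<Sum>x\<in>A. g x) w = (\<Sum>x\<in>A. wedge (g x) w)"
  by (simp add: wedge_def lin_ext_sum)

lemma wedge_zero_right [simp]: "wedge v 0 = 0"
  by (simp add: wedge_def lin_ext_def)

lemma wedge_sum_right: "wedge w (\<Sum>x\<in>A. h x) = (\<Sum>x\<in>A. wedge w (h x))"
  by (induction A rule: infinite_finite_induct) (simp_all add: wedge_add_right)

lemma partial_add: "partial i (v + w) = partial i v + partial i w"
  and partial_cscale: "partial i (cscale c v) = cscale c (partial i v)"
  and partial_zero [simp]: "partial i 0 = 0"
  by (simp_all add: partial_def lin_ext_add lin_ext_cscale)

lemma partial_sum: "partial i (\<Sum>x\<in>A. g x) = (\<Sum>x\<in>A. partial i (g x))"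
  by (simp add: partial_def lin_ext_sum)

lemma cscale_conv_mult: "cscale c v = Poly_Mapping.single 0 c * (v :: mpoly)"
  by (simp add: cscale_def mult_map_scale_conv_mult)

lemma cscale_mult_left: "cscale c v * w = cscale c (v * w :: mpoly)"
  and cscale_mult_right: "v * cscale c w = cscale c (v * w :: mpoly)"
  by (simp_all add: cscale_conv_mult mult_ac)

lemma basis_vec_mult: "basis_vec a * basis_vec b = (basis_vec (a + b) :: mpoly)"
  by (simp add: basis_vec_def mult_single)

lemma partial_mult_basis:
  "partial i (basis_vec a * basis_vec b) =
   partial i (basis_vec a) * basis_vec b + basis_vec a * partial i (basis_vec b)"
proof -
  let ?e = "Poly_Mapping.single i (1::nat)"
  have 1: "a - ?e + b = a + b - ?e" if "Poly_Mapping.lookup a i \<noteq> 0" for a b :: expo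
    using that by (intro poly_mapping_eqI) (auto simp: lookup_add lookup_minus lookup_single when_def)
  have 2: "cscale (of_nat (Poly_Mapping.lookup a i)) (basis_vec (a - ?e + b)) =
        cscale (of_nat (Poly_Mapping.lookup a i)) (basis_vec (a + b - ?e))" for a b :: expo
    by (cases "Poly_Mapping.lookup a i = 0") (simp_all add: 1[simplified])
  show ?thesis
    using 2[of a b] 2[of b a, unfolded add.commute[of b a]]
    by (simp add: partial_def basis_vec_mult cscale_mult_left cscale_mult_right lookup_add
        cvs.scale_left_distrib add.commute)
       (auto simp: add.commute)
qed

lemma partial_mult: "partial i (f * g) = partial i f * g + f * partial i g"
proof -
  have *: "partial i (basis_vec a * g) = partial i (basis_vec a) * g + basis_vec a * partial i g" for a
  proof -
    let ?T = "\<lambda>g. partial i (basis_vec a * g) = partial i (basis_vec a) * g + basis_vec a * partial i g"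
    have "?T (\<Sum>b\<in>Poly_Mapping.keys g. cscale (Poly_Mapping.lookup g b) (basis_vec b))"
      by (simp add: sum_distrib_left cscale_mult_right partial_sum partial_cscale
          partial_mult_basis cvs.scale_right_distrib sum.distrib)
    then show ?thesis by (simp flip: expand_basis)
  qed
  let ?T = "\<lambda>f. partial i (f * g) = partial i f * g + f * partial i g"
  have "?T (\<Sum>b\<in>Poly_Mapping.keys f. cscale (Poly_Mapping.lookup f b) (basis_vec b))"
    by (simp add: sum_distrib_right cscale_mult_left partial_sum partial_cscale
        * cvs.scale_right_distrib sum.distrib)
  then show ?thesis by (simp flip: expand_basis)
qed

lemma partial_lin_form: "partial i (lin_form v) = cscale (Poly_Mapping.lookup v i) 1"
proof -
  have b: "partial i (basis_vec (Poly_Mapping.single j 1)) = (if j = i then 1 else 0)" for j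
    unfolding partial_def lin_ext_basis_vec
    by (auto intro!: poly_mapping_eqI simp: basis_vec_def lookup_single when_def)
  have "partial i (lin_form v) = (\<Sum>j\<in>Poly_Mapping.keys v.
      if j = i then cscale (Poly_Mapping.lookup v j) 1 else 0)"
    unfolding lin_form_def lin_ext_def partial_sum partial_cscale b
    by (intro sum.cong) auto
  then show ?thesis
    by (simp add: sum.delta in_keys_iff)
qed

lemma partial_prod_list:
  "partial i (\<Prod>l\<leftarrow>ls. lin_form l) =
    (\<Sum>s<length ls. cscale (Poly_Mapping.lookup (ls ! s) i)
      (\<Prod>l\<leftarrow>take s ls @ drop (Suc s) ls. lin_form l))"
proof (induction ls)
  case Nil
  have "basis_vec (0::expo) = (1::mpoly)" by (simp add: basis_vec_def)
  then have "partial i 1 = partial i (basis_vec (0::expo))" by simp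
  also have "\<dots> = 0" by (simp add: partial_def)
  finally show ?case by simp
next
  case (Cons l ls)
  show ?case
    by (simp add: partial_mult partial_lin_form Cons.IH sum.lessThan_Suc_shift sum_distrib_left
        cscale_mult_left cscale_mult_right mult.assoc del: sum.lessThan_Suc)
qed

lemma partial_basis_notin: "i \<notin> Poly_Mapping.keys a \<Longrightarrow> partial i (basis_vec a) = 0"
  by (simp add: partial_def in_keys_iff)

lemma ext_deriv_tensor:
  assumes "finite S" and S: "\<And>a. a \<in> Poly_Mapping.keys f \<Longrightarrow> Poly_Mapping.keys a \<subseteq> S"
  shows "ext_deriv (tensor f \<omega>) = (\<Sum>i\<in>S. tensor (partial i f) (wedge (basis_vec i) \<omega>))"
proof -
  have tz: "tensor 0 w = 0" for w :: ext
    by (auto intro!: poly_mapping_eqI)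
  have "ext_deriv (tensor f \<omega>) =
     (\<Sum>a\<in>Poly_Mapping.keys f. \<Sum>I\<in>Poly_Mapping.keys \<omega>.
        cscale (Poly_Mapping.lookup f a) (cscale (Poly_Mapping.lookup \<omega> I)
          (\<Sum>i\<in>Poly_Mapping.keys a. tensor (partial i (basis_vec a)) (wedge_basis i I))))"
    unfolding ext_deriv_def
    by (subst tensor_def, subst lin_ext_def[of _ f], subst lin_ext_def[of _ \<omega>])
       (simp add: lin_ext_sum lin_ext_cscale cvs.scale_sum_right)
  also have "\<dots> = (\<Sum>a\<in>Poly_Mapping.keys f. \<Sum>I\<in>Poly_Mapping.keys \<omega>.
        cscale (Poly_Mapping.lookup f a) (cscale (Poly_Mapping.lookup \<omega> I)
          (\<Sum>i\<in>S. tensor (partial i (basis_vec a)) (wedge_basis i I))))"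
    by (intro sum.cong refl arg_cong[where f = "cscale _"] sum.mono_neutral_left)
       (use assms in \<open>auto simp: partial_basis_notin tz\<close>)
  also have "\<dots> = (\<Sum>i\<in>S. \<Sum>a\<in>Poly_Mapping.keys f. \<Sum>I\<in>Poly_Mapping.keys \<omega>.
        cscale (Poly_Mapping.lookup f a) (cscale (Poly_Mapping.lookup \<omega> I)
          (tensor (partial i (basis_vec a)) (wedge_basis i I))))"
    by (simp only: cvs.scale_sum_right sum.swap[where B = S])
  also have "\<dots> = (\<Sum>i\<in>S. tensor (partial i f) (wedge (basis_vec i) \<omega>))"
  proof (rule sum.cong[OF refl])
    fix i
    have "tensor (partial i (\<Sum>a\<in>Poly_Mapping.keys f. cscale (Poly_Mapping.lookup f a) (basis_vec a)))
        (wedge (basis_vec i) (\<Sum>I\<in>Poly_Mapping.keys \<omega>. cscale (Poly_Mapping.lookup \<omega> I) (basis_vec I))) =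
      (\<Sum>a\<in>Poly_Mapping.keys f. \<Sum>I\<in>Poly_Mapping.keys \<omega>.
        cscale (Poly_Mapping.lookup f a) (cscale (Poly_Mapping.lookup \<omega> I)
          (tensor (partial i (basis_vec a)) (wedge_basis i I))))"
      by (simp only: partial_sum partial_cscale wedge_sum_right wedge_cscale_right wedge_basis_vec
          tensor_sum_left tensor_cscale_left) 
         (simp only: tensor_sum_right tensor_cscale_right cvs.scale_sum_right)
    then show "(\<Sum>a\<in>Poly_Mapping.keys f. \<Sum>I\<in>Poly_Mapping.keys \<omega>.
        cscale (Poly_Mapping.lookup f a) (cscale (Poly_Mapping.lookup \<omega> I)
          (tensor (partial i (basis_vec a)) (wedge_basis i I)))) =
      tensor (partial i f) (wedge (basis_vec i) \<omega>)"
      by (simp flip: expand_basis)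
  qed
  finally show ?thesis .
qed

theorem ext_deriv_prod_list:
  "ext_deriv (tensor (\<Prod>l\<leftarrow>ls. lin_form l) \<omega>) =
    (\<Sum>s<length ls. tensor (\<Prod>l\<leftarrow>take s ls @ drop (Suc s) ls. lin_form l) (wedge (ls ! s) \<omega>))"
proof -
  let ?f = "\<Prod>l\<leftarrow>ls. lin_form l"
  define S where "S = (\<Union>a\<in>Poly_Mapping.keys ?f. Poly_Mapping.keys a) \<union>
    (\<Union>l\<in>set ls. Poly_Mapping.keys l)"
  have w: "wedge v \<omega> = (\<Sum>i\<in>S. cscale (Poly_Mapping.lookup v i) (wedge (basis_vec i) \<omega>))"
    if "v \<in> set ls" for v
  proof -
    have "wedge v \<omega> = lin_ext (\<lambda>i. wedge (basis_vec i) \<omega>) v"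
      by (simp add: wedge_def)
    then show ?thesis
      using that by (subst (asm) lin_ext_superset[of S]) (auto simp: S_def)
  qed
  have "ext_deriv (tensor ?f \<omega>) = (\<Sum>i\<in>S. tensor (partial i ?f) (wedge (basis_vec i) \<omega>))"
    by (rule ext_deriv_tensor) (auto simp: S_def)
  also have "\<dots> = (\<Sum>s<length ls. \<Sum>i\<in>S. cscale (Poly_Mapping.lookup (ls ! s) i)
      (tensor (\<Prod>l\<leftarrow>take s ls @ drop (Suc s) ls. lin_form l) (wedge (basis_vec i) \<omega>)))"
    by (simp only: partial_prod_list tensor_sum_left tensor_cscale_left)
       (rule sum.swap)
  also have "\<dots> = (\<Sum>s<length ls.
      tensor (\<Prod>l\<leftarrow>take s ls @ drop (Suc s) ls. lin_form l) (wedge (ls ! s) \<omega>))"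
    by (rule sum.cong[OF refl]) (simp add: w tensor_sum_right tensor_cscale_right)
  finally show ?thesis .
qed

lemma wedge_basis_anticommute:
  assumes "finite I"
  shows "wedge (basis_vec i) (wedge_basis j I) = - wedge (basis_vec j) (wedge_basis i I)"
proof -
  have main: "wedge (basis_vec i) (wedge_basis j I) = - wedge (basis_vec j) (wedge_basis i I)"
    if "i < j" for i j
  proof (cases "i \<in> I \<or> j \<in> I")
    case True
    then show ?thesis using that
      by (auto simp: wedge_basis_def wedge_cscale_right wedge_basis_vec)
  next
    case False
    have "{x\<in>insert j I. x < i} = {x\<in>I. x < i}" "{x\<in>insert i I. x < j} = insert i {x\<in>I. x < j}"
      using that by auto
    then show ?thesis using that False assms
      by (auto simp: wedge_basis_def wedge_cscale_right wedge_basis_vec insert_commute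
          mult.commute)
  qed
  have "wedge (basis_vec i) (wedge_basis i I) = 0"
    by (auto simp: wedge_basis_def wedge_cscale_right wedge_basis_vec)
  then show ?thesis
    using main[of i j] main[of j i] by (cases i j rule: linorder_cases) auto
qed

end

(* Let x_B be the product and e_I the exterior product of the basis vectors indexed by B and I.
   Applied to x_1 ... x_d, the flattening produces exactly the x_B with |B| = d - k, so the image
   is spanned by the vectors D(x_B (x) e_I), where D is the exterior derivative. D moves one
   element of B - I from B to I, hence preserves T = B \<inter> I and the symmetric difference U of B
   and I; on such a block it is the coboundary of a simplex on U, whose rank in degree p - s is
   (|U| - 1 choose p - s), where s = |T|. Summing over T and U gives the formula.

   The spanning half only uses the product rule and D D = 0, so it holds verbatim for w_1 ... w_d
   whenever the w_i form a basis, and the minors vanish there. For arbitrary w_i replace w_i by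
   w_i + t x_i, a basis for all but finitely many t: a minor is then a polynomial in t with
   infinitely many zeros, hence zero at t = 0 as well. *)

theory Submission
  imports Defs "Jordan_Normal_Form.Char_Poly"
begin

section \<open>Spans of basis vectors\<close>

text \<open>No coboundary rank is computed abstractly. In each block fix the vertex u = Min U. Since
  D D = 0, a generator D(x_B (x) e_I) with u in I is a signed combination of generators with u in B.
  So the pairs with u in B already span, and they correspond to the (p - s)-subsets I - B of U -
  {u}. They are independent because the term in which u itself is moved occurs in only one of them.
  The spanning argument gives a number that does not depend on the vectors w_i, hence a rank bound
  for every basis; independence is carried out for the x_i alone. For dependent w_i the obstacle is
  the exterior factor: their wedge products no longer span the p-th exterior power, so the
  generators need not cover the image. Hence the detour through w_i + t x_i. The exceptional t are
  roots of the monic polynomial det (W + t 1), where W is the coordinate matrix of the w_i.\<close>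

lemma span_linear_image:
  assumes add: "\<And>x y. f (x + y) = f x + f y"
    and scale: "\<And>c x. f (cscale c x) = cscale c (f x)"
    and gen: "\<And>x. x \<in> S \<Longrightarrow> f x \<in> cvs.span T"
    and v: "v \<in> cvs.span S"
  shows "f v \<in> cvs.span T"
  using v
proof (induction rule: cvs.span_induct_alt)
  case base
  have "f (cscale 0 0) = 0" by (simp only: scale) simp
  then show ?case by (simp add: cvs.span_zero)
next
  case (step c x y)
  then show ?case by (simp add: add scale gen cvs.span_add cvs.span_scale)
qed

lemma keys_basis_vec [simp]: "Poly_Mapping.keys (basis_vec b) = {b}"
  by (simp add: basis_vec_def)

lemma span_basis_vec: "cvs.span (basis_vec ` A) = {v. Poly_Mapping.keys v \<subseteq> A}"
proof (intro equalityI subsetI CollectI)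
  fix v :: "'a \<Rightarrow>\<^sub>0 complex" and b
  assume v: "v \<in> cvs.span (basis_vec ` A)" and "b \<in> Poly_Mapping.keys v"
  have "b \<notin> A \<longrightarrow> Poly_Mapping.lookup v b = 0"
    using v by (induction rule: cvs.span_induct_alt)
      (auto simp: lookup_add basis_vec_def lookup_single when_def split: if_splits)
  then show "b \<in> A"
    using \<open>b \<in> Poly_Mapping.keys v\<close> by (auto simp: in_keys_iff)
next
  fix v :: "'a \<Rightarrow>\<^sub>0 complex"
  assume "v \<in> {v. Poly_Mapping.keys v \<subseteq> A}"
  then have "(\<Sum>b\<in>Poly_Mapping.keys v. cscale (Poly_Mapping.lookup v b) (basis_vec b))
      \<in> cvs.span (basis_vec ` A)"
    by (intro cvs.span_sum cvs.span_scale cvs.span_base) auto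
  then show "v \<in> cvs.span (basis_vec ` A)" by (simp flip: expand_basis)
qed

lemma tensor_zero_right [simp]: "tensor v 0 = 0"
  by (auto intro!: poly_mapping_eqI)

lemma tensor_span:
  assumes v: "v \<in> cvs.span S" and w: "w \<in> cvs.span T"
    and ST: "\<And>x y. x \<in> S \<Longrightarrow> y \<in> T \<Longrightarrow> tensor x y \<in> cvs.span R"
  shows "tensor v w \<in> cvs.span R"
proof (rule span_linear_image[where f = "\<lambda>v. tensor v w", OF _ _ _ v])
  fix x assume "x \<in> S"
  show "tensor x w \<in> cvs.span R"
    by (rule span_linear_image[where f = "tensor x", OF _ _ _ w])
      (use \<open>x \<in> S\<close> ST in \<open>auto simp: tensor_add_right tensor_cscale_right\<close>)
qed (auto simp: tensor_add_left tensor_cscale_left)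

lemma wedge_span:
  assumes v: "v \<in> cvs.span S" and w: "w \<in> cvs.span T"
    and ST: "\<And>x y. x \<in> S \<Longrightarrow> y \<in> T \<Longrightarrow> wedge x y \<in> cvs.span R"
  shows "wedge v w \<in> cvs.span R"
proof (rule span_linear_image[where f = "\<lambda>v. wedge v w", OF _ _ _ v])
  fix x assume "x \<in> S"
  show "wedge x w \<in> cvs.span R"
    by (rule span_linear_image[where f = "wedge x", OF _ _ _ w])
      (use \<open>x \<in> S\<close> ST in \<open>auto simp: wedge_add_right wedge_cscale_right\<close>)
qed (auto simp: wedge_add_left wedge_cscale_left)

section \<open>Monomial bases of the symmetric and exterior powers\<close>

definition exps :: "nat \<Rightarrow> nat \<Rightarrow> expo set" where
  "exps n j = {a. Poly_Mapping.keys a \<subseteq> {1..n} \<and>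
     (\<Sum>i\<in>Poly_Mapping.keys a. Poly_Mapping.lookup a i) = j}"

text \<open>Summing over the fixed range instead of the support makes the degree visibly additive in
  the exponent vector.\<close>

lemma exps_iff: "a \<in> exps n j \<longleftrightarrow>
    Poly_Mapping.keys a \<subseteq> {1..n} \<and> (\<Sum>i=1..n. Poly_Mapping.lookup a i) = j"
proof -
  have "(\<Sum>i\<in>Poly_Mapping.keys a. Poly_Mapping.lookup a i) = (\<Sum>i=1..n. Poly_Mapping.lookup a i)"
    if "Poly_Mapping.keys a \<subseteq> {1..n}"
    using that by (intro sum.mono_neutral_left) (auto simp: in_keys_iff)
  then show ?thesis by (auto simp: exps_def)
qed

definition subsets :: "nat \<Rightarrow> nat \<Rightarrow> nat set set" where
  "subsets n p = {I. I \<subseteq> {1..n} \<and> card I = p}"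

lemma base_space_span: "base_space n = cvs.span (basis_vec ` {1..n})"
  by (simp add: span_basis_vec base_space_def)

lemma sym_power_span: "sym_power n j = cvs.span (basis_vec ` exps n j)"
  by (auto simp: span_basis_vec sym_power_def exps_def subset_iff)

lemma ext_power_span: "ext_power n p = cvs.span (basis_vec ` subsets n p)"
  by (auto simp: span_basis_vec ext_power_def subsets_def)

lemma tensor_space_span:
  "tensor_space (cvs.span S) (cvs.span T) = cvs.span {tensor v w | v w. v \<in> S \<and> w \<in> T}"
proof
  show "tensor_space (cvs.span S) (cvs.span T) \<subseteq> cvs.span {tensor v w | v w. v \<in> S \<and> w \<in> T}"
    unfolding tensor_space_def
  proof (intro cvs.span_minimal cvs.subspace_span subsetI)
    fix x assume "x \<in> {tensor v w | v w. v \<in> cvs.span S \<and> w \<in> cvs.span T}"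
    then obtain v w where x: "x = tensor v w" and vw: "v \<in> cvs.span S" "w \<in> cvs.span T" by blast
    show "x \<in> cvs.span {tensor v w | v w. v \<in> S \<and> w \<in> T}"
      unfolding x by (rule tensor_span[OF vw]) (blast intro: cvs.span_base)
  qed
  show "cvs.span {tensor v w | v w. v \<in> S \<and> w \<in> T} \<subseteq> tensor_space (cvs.span S) (cvs.span T)"
    unfolding tensor_space_def by (intro cvs.span_mono) (blast intro: cvs.span_base)
qed

lemma koszul_dom_span:
  "koszul_dom n k p = cvs.span (basis_vec ` (exps n k \<times> subsets n p))"
  unfolding koszul_dom_def sym_power_span ext_power_span tensor_space_span
proof (rule arg_cong[where f = cvs.span], intro equalityI subsetI)
  fix x :: "expo \<times> nat set \<Rightarrow>\<^sub>0 complex"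
  assume "x \<in> basis_vec ` (exps n k \<times> subsets n p)"
  then obtain a I where "a \<in> exps n k" "I \<in> subsets n p" "x = tensor (basis_vec a) (basis_vec I)"
    by (auto simp: tensor_basis_vec)
  then show "x \<in> {tensor v w | v w. v \<in> basis_vec ` exps n k \<and> w \<in> basis_vec ` subsets n p}"
    by blast
qed (auto simp: tensor_basis_vec)

section \<open>Wedge products and products of linear forms\<close>

lemma wedge_expand:
  "wedge v \<omega> = (\<Sum>i\<in>Poly_Mapping.keys v. cscale (Poly_Mapping.lookup v i) (wedge (basis_vec i) \<omega>))"
  by (simp add: wedge_def lin_ext_def[of _ v])

lemma wedge_mem_ext_power:
  assumes "v \<in> base_space n" "\<omega> \<in> ext_power n p"
  shows "wedge v \<omega> \<in> ext_power n (Suc p)"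
  using assms unfolding base_space_span ext_power_span
proof (rule wedge_span)
  fix x y :: "_ \<Rightarrow>\<^sub>0 complex"
  assume "x \<in> basis_vec ` {1..n}" "y \<in> basis_vec ` subsets n p"
  then obtain i I where x: "x = basis_vec i" "y = basis_vec I" and i: "i \<in> {1..n}" "I \<in> subsets n p"
    by auto
  have fin: "finite I" using i by (auto simp: subsets_def intro: finite_subset)
  show "wedge x y \<in> cvs.span (basis_vec ` subsets n (Suc p))"
  proof (cases "i \<in> I")
    case False
    then have "insert i I \<in> subsets n (Suc p)" using i fin by (auto simp: subsets_def)
    then show ?thesis using False
      by (simp add: x wedge_basis_vec wedge_basis_def cvs.span_scale cvs.span_base)
  qed (simp add: x wedge_basis_vec wedge_basis_def cvs.span_zero)
qed

text \<open>Bilinear extension of the rule for basis vectors. Membership in \<open>ext_power\<close>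
  makes every label of \<omega> finite, so that the cardinalities in the signs are
  meaningful.\<close>

lemma wedge_anticommute:
  assumes "\<omega> \<in> ext_power n p"
  shows "wedge u (wedge v \<omega>) = - wedge v (wedge u \<omega>)"
proof -
  have 1: "wedge (basis_vec i) (wedge (basis_vec j) \<omega>) = - wedge (basis_vec j) (wedge (basis_vec i) \<omega>)"
    for i j
    using assms unfolding ext_power_span
  proof (induction rule: cvs.span_induct_alt)
    case (step c x y)
    then obtain I where I: "I \<in> subsets n p" "x = basis_vec I" by auto
    then have "finite I" by (auto simp: subsets_def intro: finite_subset)
    then show ?case
      using I(2) wedge_basis_anticommute[of I i j]
      by (simp add: wedge_add_right wedge_cscale_right step wedge_basis_vec)
  qed simp
  have "wedge u (wedge v \<omega>) = (\<Sum>i\<in>Poly_Mapping.keys u. \<Sum>j\<in>Poly_Mapping.keys v.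
      cscale (Poly_Mapping.lookup u i) (cscale (Poly_Mapping.lookup v j)
        (wedge (basis_vec i) (wedge (basis_vec j) \<omega>))))"
    unfolding wedge_expand[of u "wedge v \<omega>"] unfolding wedge_expand[of v \<omega>]
    by (simp only: wedge_sum_right wedge_cscale_right cvs.scale_sum_right)
  also have "\<dots> = (\<Sum>j\<in>Poly_Mapping.keys v. \<Sum>i\<in>Poly_Mapping.keys u.
      - cscale (Poly_Mapping.lookup v j) (cscale (Poly_Mapping.lookup u i)
        (wedge (basis_vec j) (wedge (basis_vec i) \<omega>))))"
    by (subst sum.swap, intro sum.cong refl, subst 1) (simp add: mult.commute)
  also have "\<dots> = - wedge v (wedge u \<omega>)"
    unfolding wedge_expand[of v "wedge u \<omega>"] unfolding wedge_expand[of u \<omega>]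
    by (simp only: wedge_sum_right wedge_cscale_right cvs.scale_sum_right sum_negf)
  finally show ?thesis .
qed

lemma uminus_self_zero: "x = - x \<Longrightarrow> x = (0 :: 'b \<Rightarrow>\<^sub>0 complex)"
proof (rule poly_mapping_eqI)
  fix k assume "x = - x"
  then have "Poly_Mapping.lookup x k = - Poly_Mapping.lookup x k" by (metis lookup_uminus)
  then show "Poly_Mapping.lookup x k = Poly_Mapping.lookup 0 k" by simp
qed

lemma wedge_self:
  assumes "\<omega> \<in> ext_power n p"
  shows "wedge v (wedge v \<omega>) = 0"
  by (rule uminus_self_zero, rule wedge_anticommute[OF assms])

text \<open>Iterated left multiplication onto the unit \<open>basis_vec {}\<close> of the exterior
  algebra. Sorting the index set fixes the order of the factors and thereby the sign of
  \<open>wedge_prod\<close>.\<close>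

definition wedge_list :: "(nat \<Rightarrow> (nat \<Rightarrow>\<^sub>0 complex)) \<Rightarrow> nat list \<Rightarrow> ext" where
  "wedge_list w xs = foldr (\<lambda>i. wedge (w i)) xs (basis_vec {})"

abbreviation wedge_prod :: "(nat \<Rightarrow> (nat \<Rightarrow>\<^sub>0 complex)) \<Rightarrow> nat set \<Rightarrow> ext" where
  "wedge_prod w I \<equiv> wedge_list w (sorted_list_of_set I)"

lemma wedge_list_simps [simp]:
  "wedge_list w [] = basis_vec {}"
  "wedge_list w (x # xs) = wedge (w x) (wedge_list w xs)"
  by (simp_all add: wedge_list_def)

lemma wedge_list_mem_ext_power:
  assumes "\<And>i. i \<in> set xs \<Longrightarrow> w i \<in> base_space n"
  shows "wedge_list w xs \<in> ext_power n (length xs)"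
  using assms
  by (induction xs)
    (auto intro: wedge_mem_ext_power simp: ext_power_def[of _ 0])

text \<open>Moving \<open>w i\<close> to its sorted place passes one factor for each smaller index,
  and each passage costs a sign; a repeated index meets itself and gives 0. This is the rule of
  \<open>wedge_basis\<close>, so sign computations for the x_i hold unchanged for arbitrary
  vectors.\<close>

lemma wedge_wedge_list:
  assumes "\<And>j. j \<in> set xs \<Longrightarrow> w j \<in> base_space n" "sorted_wrt (<) xs"
  shows "wedge (w i) (wedge_list w xs) =
    (if i \<in> set xs then 0
     else cscale ((-1) ^ card {j\<in>set xs. j < i}) (wedge_list w (insort i xs)))"
  using assms
proof (induction xs)
  case Nil
  then show ?case by simp
next
  case (Cons x xs)
  have mem: "wedge_list w xs \<in> ext_power n (length xs)"
    by (rule wedge_list_mem_ext_power) (use Cons.prems in auto)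
  consider "i = x" | "i < x" | "x < i" by (rule linorder_cases[of i x]) auto
  then show ?case
  proof cases
    case 1
    then show ?thesis by (simp add: wedge_self[OF mem])
  next
    case 2
    then have "i \<notin> set (x # xs)" "{j\<in>set (x # xs). j < i} = {}"
      using Cons.prems(2) by auto
    moreover have "insort i (x # xs) = i # x # xs" using 2 by simp
    ultimately show ?thesis by (simp only: wedge_list_simps) simp
  next
    case 3
    have "{j\<in>set (x # xs). j < i} = insert x {j\<in>set xs. j < i}" "x \<notin> set xs"
      using 3 Cons.prems(2) by auto
    then have c: "card {j\<in>set (x # xs). j < i} = Suc (card {j\<in>set xs. j < i})"
      by simp
    have "wedge (w i) (wedge_list w (x # xs)) = - wedge (w x) (wedge (w i) (wedge_list w xs))"
      unfolding wedge_list_simps by (rule wedge_anticommute[OF mem])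
    also have "wedge (w i) (wedge_list w xs) = (if i \<in> set xs then 0
     else cscale ((-1) ^ card {j\<in>set xs. j < i}) (wedge_list w (insort i xs)))"
      using Cons by auto
    finally show ?thesis using 3 unfolding c
      by (auto simp: wedge_cscale_right)
  qed
qed

lemma wedge_wedge_prod:
  assumes "\<And>j. j \<in> I \<Longrightarrow> w j \<in> base_space n" "finite I"
  shows "wedge (w i) (wedge_prod w I) =
    (if i \<in> I then 0
     else cscale ((-1) ^ card {j\<in>I. j < i}) (wedge_prod w (insert i I)))"
  using wedge_wedge_list[of "sorted_list_of_set I" w n i] assms
  by (auto simp: sorted_list_of_set_insert)

text \<open>Peel off the minimum: no remaining index is smaller, so every step has sign +1.\<close>

lemma wedge_prod_basis_vec:
  "finite I \<Longrightarrow> wedge_prod basis_vec I = basis_vec I"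
proof (induction "card I" arbitrary: I)
  case 0
  then show ?case by simp
next
  case (Suc m)
  then have ne: "I \<noteq> {}" by auto
  let ?J = "I - {Min I}"
  have M: "Min I \<in> I" "\<And>j. j \<in> I \<Longrightarrow> Min I \<le> j" using ne Suc by auto
  have "sorted_list_of_set I = Min I # sorted_list_of_set ?J"
    using ne Suc.prems by (rule sorted_list_of_set_nonempty[rotated])
  moreover have "wedge_prod basis_vec ?J = basis_vec ?J"
    using Suc M by (intro Suc.hyps) auto
  moreover have "card {j\<in>?J. j < Min I} = 0"
    using M(2) by (metis (no_types, lifting) DiffD1 card.empty empty_Collect_eq not_less)
  then have "wedge_basis (Min I) ?J = cscale ((-1) ^ 0) (basis_vec (insert (Min I) ?J))"
    unfolding wedge_basis_def by (simp only:) simp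
  moreover have "insert (Min I) ?J = I" using M by auto
  ultimately show ?case
    by (simp add: wedge_basis_vec del: insert_Diff_single)
qed

text \<open>Expand the leading factor in the \<open>w i\<close> and sort it into the product of the
  others. The auxiliary claim ranges over all lists of indices, sorted or not, which makes this a
  plain induction.\<close>

lemma ext_power_span_wedge_prod:
  assumes w: "\<And>i. i \<in> {1..n} \<Longrightarrow> w i \<in> base_space n"
    and e: "\<And>i. i \<in> {1..n} \<Longrightarrow> basis_vec i \<in> cvs.span (w ` {1..n})"
  shows "ext_power n p \<subseteq> cvs.span (wedge_prod w ` subsets n p)"
proof -
  have list: "wedge_list basis_vec xs \<in> cvs.span (wedge_prod w ` subsets n (length xs))"
    if "set xs \<subseteq> {1..n}" for xs
    using that
  proof (induction xs)
    case Nil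
    have "{} \<in> subsets n 0" by (simp add: subsets_def)
    then have "wedge_prod w {} \<in> wedge_prod w ` subsets n 0" by (rule imageI)
    then show ?case by (simp add: cvs.span_base)
  next
    case (Cons x xs)
    have "wedge (basis_vec x) (wedge_list basis_vec xs)
        \<in> cvs.span (wedge_prod w ` subsets n (Suc (length xs)))"
    proof (rule wedge_span)
      show "basis_vec x \<in> cvs.span (w ` {1..n})" using e Cons.prems by auto
      show "wedge_list basis_vec xs \<in> cvs.span (wedge_prod w ` subsets n (length xs))"
        using Cons by auto
    next
      fix u v assume "u \<in> w ` {1..n}" "v \<in> wedge_prod w ` subsets n (length xs)"
      then obtain i I where i: "i \<in> {1..n}" "u = w i" and I: "I \<subseteq> {1..n}" "card I = length xs"
        and v: "v = wedge_prod w I"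
        by (auto simp: subsets_def)
      have fin: "finite I" using I(1) by (rule finite_subset) simp
      have wI: "\<And>j. j \<in> I \<Longrightarrow> w j \<in> base_space n" using I w by auto
      have "wedge_prod w (insert i I) \<in> cvs.span (wedge_prod w ` subsets n (Suc (length xs)))"
        if "i \<notin> I"
        using that i I fin by (intro cvs.span_base imageI) (auto simp: subsets_def)
      then show "wedge u v \<in> cvs.span (wedge_prod w ` subsets n (Suc (length xs)))"
        using wedge_wedge_prod[where w = w and I = I and n = n and i = i, OF wI fin]
        by (auto simp: i v cvs.span_scale cvs.span_zero)
    qed
    then show ?case by simp
  qed
  show ?thesis
    unfolding ext_power_span
  proof (intro cvs.span_minimal cvs.subspace_span subsetI)
    fix u :: ext assume "u \<in> basis_vec ` subsets n p"
    then obtain I where u: "u = basis_vec I" and I: "I \<subseteq> {1..n}" "card I = p"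
      by (auto simp: subsets_def)
    have fin: "finite I" using I(1) by (rule finite_subset) simp
    show "u \<in> cvs.span (wedge_prod w ` subsets n p)"
      using list[of "sorted_list_of_set I"] fin I
      by (simp add: u wedge_prod_basis_vec)
  qed
qed

section \<open>Products of linear forms and the exterior derivative\<close>

definition lin_prod :: "(nat \<Rightarrow> (nat \<Rightarrow>\<^sub>0 complex)) \<Rightarrow> nat set \<Rightarrow> mpoly" where
  "lin_prod w B = (\<Prod>i\<in>B. lin_form (w i))"

lemma basis_vec_zero: "basis_vec 0 = (1 :: mpoly)"
  by (simp add: basis_vec_def)

lemma partial_one: "partial i 1 = 0"
proof -
  have "partial i (basis_vec 0) = 0" by (simp add: partial_def)
  then show ?thesis by (simp add: basis_vec_zero)
qed

lemma partial_lin_prod: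
  assumes "finite B"
  shows "partial i (lin_prod w B) =
    (\<Sum>j\<in>B. cscale (Poly_Mapping.lookup (w j) i) (lin_prod w (B - {j})))"
  using assms
proof (induction B rule: finite_induct)
  case empty
  then show ?case by (simp add: lin_prod_def partial_one)
next
  case (insert x B)
  have "insert x B - {j} = insert x (B - {j})" "x \<notin> B - {j}" if "j \<in> B" for j
    using that insert by auto
  then have "lin_form (w x) * lin_prod w (B - {j}) = lin_prod w (insert x B - {j})" if "j \<in> B" for j
    using that insert by (simp add: lin_prod_def)
  moreover have "lin_prod w (insert x B) = lin_form (w x) * lin_prod w B"
    using insert by (simp add: lin_prod_def)
  moreover have "insert x B - {x} = B" using insert by auto
  ultimately show ?case
    using insert by (simp add: partial_mult partial_lin_form insert.IH sum_distrib_left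
      cscale_mult_left cscale_mult_right)
qed

lemma ext_deriv_lin_prod:
  assumes "finite B"
  shows "ext_deriv (tensor (lin_prod w B) \<omega>) =
    (\<Sum>j\<in>B. tensor (lin_prod w (B - {j})) (wedge (w j) \<omega>))"
proof -
  \<comment> \<open>A finite set with every variable of the polynomial and of the vectors
    \<open>w j\<close>, so that both coordinate expansions run over the same indices.\<close>
  define S where "S = (\<Union>a\<in>Poly_Mapping.keys (lin_prod w B). Poly_Mapping.keys a) \<union>
    (\<Union>j\<in>B. Poly_Mapping.keys (w j))"
  have fin: "finite S" using assms by (auto simp: S_def)
  have w: "wedge (w j) \<omega> = (\<Sum>i\<in>S. cscale (Poly_Mapping.lookup (w j) i) (wedge (basis_vec i) \<omega>))"
    if "j \<in> B" for j
    unfolding wedge_expand[of "w j"]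
    by (rule sum.mono_neutral_left) (use fin that in \<open>auto simp: S_def in_keys_iff\<close>)
  have "ext_deriv (tensor (lin_prod w B) \<omega>) =
      (\<Sum>i\<in>S. tensor (partial i (lin_prod w B)) (wedge (basis_vec i) \<omega>))"
    by (rule ext_deriv_tensor[OF fin]) (auto simp: S_def)
  also have "\<dots> = (\<Sum>j\<in>B. \<Sum>i\<in>S. cscale (Poly_Mapping.lookup (w j) i)
      (tensor (lin_prod w (B - {j})) (wedge (basis_vec i) \<omega>)))"
    by (simp only: partial_lin_prod[OF assms] tensor_sum_left tensor_cscale_left) (rule sum.swap)
  also have "\<dots> = (\<Sum>j\<in>B. tensor (lin_prod w (B - {j})) (wedge (w j) \<omega>))"
    by (rule sum.cong[OF refl]) (simp add: w tensor_sum_right tensor_cscale_right)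
  finally show ?thesis .
qed

lemma ext_deriv_add: "ext_deriv (x + y) = ext_deriv x + ext_deriv y"
  and ext_deriv_cscale: "ext_deriv (cscale c x) = cscale c (ext_deriv x)"
  and ext_deriv_sum: "ext_deriv (\<Sum>i\<in>A. g i) = (\<Sum>i\<in>A. ext_deriv (g i))"
  by (simp_all add: ext_deriv_def lin_ext_add lin_ext_cscale lin_ext_sum)

lemma tensor_uminus_right: "tensor v (- w) = - tensor v w"
  by (auto intro!: poly_mapping_eqI)

text \<open>The second derivative is a double sum over the two removed factors. It is antisymmetric:
  the wedge factors anticommute, while the remaining product does not depend on the order of
  removal.\<close>

lemma ext_deriv_ext_deriv_lin_prod:
  assumes "finite B" "\<omega> \<in> ext_power n p"
  shows "ext_deriv (ext_deriv (tensor (lin_prod w B) \<omega>)) = 0"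
proof -
  \<comment> \<open>The diagonal \<open>i = j\<close> is no term of the derivative, but antisymmetry
    makes \<open>F i i\<close> vanish, so the sum may run over the full square.\<close>
  define F where "F i j = tensor (lin_prod w (B - {i} - {j})) (wedge (w j) (wedge (w i) \<omega>))" for i j
  have anti: "F i j = - F j i" for i j
  proof -
    have "B - {j} - {i} = B - {i} - {j}" by auto
    then show ?thesis
      using wedge_anticommute[OF assms(2), of "w j" "w i"] by (simp add: F_def tensor_uminus_right)
  qed
  have diag: "F i i = 0" for i
    by (rule uminus_self_zero, rule anti)
  have eq: "ext_deriv (ext_deriv (tensor (lin_prod w B) \<omega>)) = (\<Sum>i\<in>B. \<Sum>j\<in>B. F i j)"
  proof -
    have "(\<Sum>j\<in>B - {i}. F i j) = (\<Sum>j\<in>B. F i j)" for i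
      using assms(1) diag by (intro sum.mono_neutral_left) auto
    then show ?thesis
      using assms(1) by (simp add: ext_deriv_lin_prod ext_deriv_sum) (simp add: F_def)
  qed
  have "(\<Sum>i\<in>B. \<Sum>j\<in>B. F i j) = - (\<Sum>i\<in>B. \<Sum>j\<in>B. F i j)"
    unfolding sum_negf[symmetric]
    by (subst sum.swap) (intro sum.cong refl anti)
  then show ?thesis unfolding eq by (rule uminus_self_zero)
qed

section \<open>Flattenings of products of linear forms\<close>

lemma funpow_partial_linear:
  "(partial i ^^ m) (f + g) = (partial i ^^ m) f + (partial i ^^ m) g"
  "(partial i ^^ m) (cscale c f) = cscale c ((partial i ^^ m) f)"
  by (induction m) (simp_all add: partial_add partial_cscale)

lemma partials_add: "partials a (f + g) = partials a f + partials a g"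
proof -
  have "fold (\<lambda>i. partial i ^^ m i) xs (f + g) =
      fold (\<lambda>i. partial i ^^ m i) xs f + fold (\<lambda>i. partial i ^^ m i) xs g" for m xs
    by (induction xs arbitrary: f g) (simp_all add: funpow_partial_linear)
  then show ?thesis by (simp add: partials_def)
qed

lemma partials_cscale: "partials a (cscale c f) = cscale c (partials a f)"
proof -
  have "fold (\<lambda>i. partial i ^^ m i) xs (cscale c f) =
      cscale c (fold (\<lambda>i. partial i ^^ m i) xs f)" for m xs
    by (induction xs arbitrary: f) (simp_all add: funpow_partial_linear)
  then show ?thesis by (simp add: partials_def)
qed

text \<open>Serves two gradings: the spans of the m-fold subproducts of a product of linear forms,
  and the symmetric powers. Truncated subtraction is consistent, since \<open>X 0\<close> is then
  closed under derivatives.\<close>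

lemma partials_mem_graded:
  assumes X: "\<And>i m f. f \<in> X m \<Longrightarrow> partial i f \<in> X (m - 1)" and f: "f \<in> X m"
  shows "partials a f \<in> X (m - (\<Sum>i\<in>Poly_Mapping.keys a. Poly_Mapping.lookup a i))"
proof -
  have pow: "(partial i ^^ l) f \<in> X (m - l)" if "f \<in> X m" for i l m f
  proof (induction l)
    case (Suc l)
    from X[OF Suc, of i] show ?case by simp
  qed (use that in simp)
  have "fold (\<lambda>i. partial i ^^ e i) xs f \<in> X (m - (\<Sum>i\<leftarrow>xs. e i))" if "f \<in> X m" for e xs f m
    using that
  proof (induction xs arbitrary: f m)
    case (Cons x xs)
    from Cons.IH[OF pow[OF Cons.prems]] show ?case by (simp add: diff_diff_left)
  qed simp
  from this[OF f, of "Poly_Mapping.lookup a" "sorted_list_of_set (Poly_Mapping.keys a)"]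
  show ?thesis by (simp add: partials_def sum_list_distinct_conv_sum_set)
qed

text \<open>With the composition collapsed to one linear extension, linearity in the argument and in
  the polynomial can both be read off.\<close>

lemma koszul_flattening_lin_ext:
  "koszul_flattening Q v = lin_ext (\<lambda>(a, I). ext_deriv (tensor (partials a Q) (basis_vec I))) v"
proof -
  have "ext_deriv (lin_ext f v) = lin_ext (\<lambda>b. ext_deriv (f b)) v" for f :: "expo \<times> nat set \<Rightarrow> _"
    by (simp add: lin_ext_def ext_deriv_sum ext_deriv_cscale)
  then show ?thesis
    by (simp add: koszul_flattening_def tensor_map_def flattening_def split_def)
qed

lemma koszul_flattening_add: "koszul_flattening Q (v + w) = koszul_flattening Q v + koszul_flattening Q w"
  and koszul_flattening_cscale: "koszul_flattening Q (cscale c v) = cscale c (koszul_flattening Q v)"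
  and koszul_flattening_basis_vec:
    "koszul_flattening Q (basis_vec (a, I)) = ext_deriv (tensor (partials a Q) (basis_vec I))"
  by (simp_all add: koszul_flattening_lin_ext lin_ext_add lin_ext_cscale)

lemma koszul_flattening_add_left:
  "koszul_flattening (Q + Q') v = koszul_flattening Q v + koszul_flattening Q' v"
  by (simp add: koszul_flattening_lin_ext lin_ext_def split_def partials_add tensor_add_left
      ext_deriv_add cvs.scale_right_distrib sum.distrib)

lemma koszul_flattening_cscale_left:
  "koszul_flattening (cscale c Q) v = cscale c (koszul_flattening Q v)"
  by (simp add: koszul_flattening_lin_ext lin_ext_def split_def partials_cscale tensor_cscale_left
      ext_deriv_cscale cvs.scale_sum_right mult.commute)

lemma finite_subsets: "finite (subsets n p)"
  by (rule finite_subset[of _ "Pow {1..n}"]) (auto simp: subsets_def)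

lemma subsets_finite: "I \<in> subsets n p \<Longrightarrow> finite I"
  by (auto simp: subsets_def intro: finite_subset)

text \<open>Each differentiation deletes one factor from every subproduct, whatever the vectors
  \<open>w i\<close> are.\<close>

lemma partials_lin_prod_mem:
  "partials a (lin_prod w {1..n}) \<in> cvs.span (lin_prod w `
     subsets n (n - (\<Sum>i\<in>Poly_Mapping.keys a. Poly_Mapping.lookup a i)))"
proof (rule partials_mem_graded)
  fix i m f assume "f \<in> cvs.span (lin_prod w ` subsets n m)"
  then show "partial i f \<in> cvs.span (lin_prod w ` subsets n (m - 1))"
  proof (rule span_linear_image[rotated 3])
    fix f assume "f \<in> lin_prod w ` subsets n m"
    then obtain B where B: "B \<in> subsets n m" "f = lin_prod w B" by auto
    have "B - {j} \<in> subsets n (m - 1)" if "j \<in> B" for j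
      using B(1) subsets_finite[OF B(1)] that by (auto simp: subsets_def)
    then show "partial i f \<in> cvs.span (lin_prod w ` subsets n (m - 1))"
      unfolding B(2) partial_lin_prod[OF subsets_finite[OF B(1)]]
      by (intro cvs.span_sum cvs.span_scale cvs.span_base imageI)
  qed (simp_all add: partial_add partial_cscale)
next
  show "lin_prod w {1..n} \<in> cvs.span (lin_prod w ` subsets n n)"
    by (rule cvs.span_base) (simp add: subsets_def)
qed

section \<open>Generators of the image and their relations\<close>

definition koszul_gen :: "(nat \<Rightarrow> (nat \<Rightarrow>\<^sub>0 complex)) \<Rightarrow> nat set \<Rightarrow> nat set \<Rightarrow>
    (expo \<times> nat set \<Rightarrow>\<^sub>0 complex)" where
  "koszul_gen w B I = ext_deriv (tensor (lin_prod w B) (wedge_prod w I))"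

text \<open>The incidence sign of the simplicial coboundary: the cost of sorting the new vertex
  \<open>j\<close> into the simplex \<open>I\<close>.\<close>

definition sign_at :: "nat set \<Rightarrow> nat \<Rightarrow> complex" where
  "sign_at I j = (-1) ^ card {l\<in>I. l < j}"

lemma koszul_gen_expand:
  assumes w: "\<And>i. i \<in> {1..n} \<Longrightarrow> w i \<in> base_space n" and "finite B" and I: "I \<subseteq> {1..n}"
  shows "koszul_gen w B I = (\<Sum>j\<in>B - I. cscale (sign_at I j)
    (tensor (lin_prod w (B - {j})) (wedge_prod w (insert j I))))"
proof -
  have wI: "\<And>j. j \<in> I \<Longrightarrow> w j \<in> base_space n" and fin: "finite I"
    using w I finite_subset by auto
  have "koszul_gen w B I = (\<Sum>j\<in>B. tensor (lin_prod w (B - {j})) (wedge (w j) (wedge_prod w I)))"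
    unfolding koszul_gen_def by (rule ext_deriv_lin_prod) fact
  also have "\<dots> = (\<Sum>j\<in>B - I. tensor (lin_prod w (B - {j})) (wedge (w j) (wedge_prod w I)))"
    using assms(2) by (intro sum.mono_neutral_right)
      (auto simp: wedge_wedge_prod[where w = w and I = I, OF wI fin])
  also have "\<dots> = (\<Sum>j\<in>B - I. cscale (sign_at I j)
    (tensor (lin_prod w (B - {j})) (wedge_prod w (insert j I))))"
    by (intro sum.cong refl)
      (auto simp: wedge_wedge_prod[where w = w and I = I, OF wI fin] tensor_cscale_right sign_at_def)
  finally show ?thesis .
qed

text \<open>D D = 0 with the inner derivative expanded: a linear relation among generators whose
  first set has one element less than \<open>B\<close> and whose second has one more than
  \<open>I\<close>.\<close>

lemma koszul_gen_relation:
  assumes w: "\<And>i. i \<in> {1..n} \<Longrightarrow> w i \<in> base_space n" and "finite B" and I: "I \<subseteq> {1..n}"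
  shows "(\<Sum>j\<in>B - I. cscale (sign_at I j) (koszul_gen w (B - {j}) (insert j I))) = 0"
proof -
  have fin: "finite I" using I finite_subset by auto
  have "wedge_prod w I \<in> ext_power n (length (sorted_list_of_set I))"
    using w I fin by (intro wedge_list_mem_ext_power) auto
  then have "ext_deriv (koszul_gen w B I) = 0"
    unfolding koszul_gen_def by (rule ext_deriv_ext_deriv_lin_prod[OF \<open>finite B\<close>])
  then show ?thesis
    by (simp only: koszul_gen_expand[where w = w and I = I, OF w \<open>finite B\<close> I]
        ext_deriv_sum ext_deriv_cscale koszul_gen_def[symmetric])
qed

text \<open>With \<open>T = B \<inter> I\<close> and \<open>U = sym_diff B I\<close>, every term of \<open>koszul_gen w B I\<close> has the same
  \<open>T\<close> and \<open>U\<close>, and on the part with given \<open>T\<close> and \<open>U\<close> the Koszul map is, up to signs, the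
  coboundary of the full simplex on \<open>U\<close> (acting on \<open>I - B\<close>). A good pair is one for which
  \<open>I - B\<close> avoids the vertex \<open>Min U\<close>.\<close>

definition good_pairs :: "nat \<Rightarrow> nat \<Rightarrow> nat \<Rightarrow> (nat set \<times> nat set) set" where
  "good_pairs n b p = {(B, I). B \<in> subsets n b \<and> I \<in> subsets n p \<and>
     sym_diff B I \<noteq> {} \<and> Min (sym_diff B I) \<in> B}"

abbreviation good_gens :: "(nat \<Rightarrow> (nat \<Rightarrow>\<^sub>0 complex)) \<Rightarrow> nat \<Rightarrow> nat \<Rightarrow> nat \<Rightarrow>
    (expo \<times> nat set \<Rightarrow>\<^sub>0 complex) set" where
  "good_gens w n b p \<equiv> (\<lambda>(B, I). koszul_gen w B I) ` good_pairs n b p"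

lemma finite_good_pairs: "finite (good_pairs n b p)"
  by (rule finite_subset[of _ "subsets n b \<times> subsets n p"])
    (auto simp: good_pairs_def finite_subsets)

text \<open>If the least element u of the symmetric difference lies in \<open>I\<close>, take the
  relation for \<open>insert u B\<close> and \<open>I - {u}\<close>. Its term at u is the given
  generator up to sign; every other term leaves u in the first set and keeps the symmetric
  difference, so it is good.\<close>

lemma koszul_gen_mem_span_good_gens:
  assumes w: "\<And>i. i \<in> {1..n} \<Longrightarrow> w i \<in> base_space n"
    and B: "B \<in> subsets n b" and I: "I \<in> subsets n p"
  shows "koszul_gen w B I \<in> cvs.span (good_gens w n b p)"
proof -
  let ?U = "sym_diff B I"
  have fin: "finite B" "finite I" and sub: "B \<subseteq> {1..n}" "I \<subseteq> {1..n}"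
    using subsets_finite B I by (auto simp: subsets_def)
  have finU: "finite ?U" using fin by simp
  consider "?U = {}" | "?U \<noteq> {}" "Min ?U \<in> B" | "?U \<noteq> {}" "Min ?U \<notin> B" by blast
  then show ?thesis
  proof cases
    case 1
    then have "B - I = {}" by auto
    then have "koszul_gen w B I = 0"
      by (simp only: koszul_gen_expand[where w = w and I = I, OF w fin(1) sub(2)] sum.empty)
    then show ?thesis by (simp add: cvs.span_zero)
  next
    case 2
    then have "(B, I) \<in> good_pairs n b p" using B I by (simp add: good_pairs_def)
    then show ?thesis by (intro cvs.span_base) (auto intro: rev_image_eqI)
  next
    case 3
    define u where "u = Min ?U"
    have "u \<in> ?U" using Min_in[OF finU 3(1)] by (simp add: u_def)
    then have u: "u \<in> I" "u \<notin> B" using 3 by (auto simp: u_def)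
    let ?C = "insert u B" and ?J = "I - {u}"
    have "?J \<subseteq> {1..n}" using sub by auto
    from koszul_gen_relation[where w = w and B = ?C, OF w _ this]
    have "(\<Sum>j\<in>?C - ?J. cscale (sign_at ?J j) (koszul_gen w (?C - {j}) (insert j ?J))) = 0"
      using fin by blast
    moreover have "?C - ?J = insert u (B - I)" "?C - {u} = B" "insert u ?J = I" using u by auto
    ultimately have rel: "cscale (sign_at ?J u) (koszul_gen w B I) +
        (\<Sum>j\<in>B - I. cscale (sign_at ?J j) (koszul_gen w (?C - {j}) (insert j ?J))) = 0"
      using fin u by simp
    define R where "R = (\<Sum>j\<in>B - I. cscale (sign_at ?J j) (koszul_gen w (?C - {j}) (insert j ?J)))"
    have "R \<in> cvs.span (good_gens w n b p)"
      unfolding R_def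
    proof (intro cvs.span_sum cvs.span_scale cvs.span_base)
      fix j assume j: "j \<in> B - I"
      have "sym_diff (?C - {j}) (insert j ?J) = ?U" using u j by auto
      moreover have "?C - {j} \<in> subsets n b" using B j u fin sub by (auto simp: subsets_def)
      moreover have "insert j ?J \<in> subsets n p"
        using I j u fin sub card_Suc_Diff1[OF fin(2) u(1)] by (auto simp: subsets_def)
      moreover have "u \<in> ?C - {j}" using u j by auto
      ultimately have "(?C - {j}, insert j ?J) \<in> good_pairs n b p"
        using 3(1) unfolding good_pairs_def u_def mem_Collect_eq case_prod_conv
        by (simp only: simp_thms)
      then show "koszul_gen w (?C - {j}) (insert j ?J) \<in> good_gens w n b p"
        by (auto intro: rev_image_eqI)
    qed
    then have "cscale (- sign_at ?J u) R \<in> cvs.span (good_gens w n b p)" by (rule cvs.span_scale)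
    \<comment> \<open>The coefficient of the given generator is its own inverse, so the relation can
      be solved for that generator.\<close>
    moreover have "sign_at ?J u * sign_at ?J u = 1"
      by (simp add: sign_at_def flip: power_add mult_2)
    then have "cscale (- sign_at ?J u) (cscale (sign_at ?J u) (koszul_gen w B I) + R)
        = cscale (- sign_at ?J u) R - koszul_gen w B I"
      by (simp add: cvs.scale_right_distrib)
    then have "koszul_gen w B I = cscale (- sign_at ?J u) R"
      using rel by (simp add: R_def)
    ultimately show ?thesis by simp
  qed
qed

text \<open>Upper bound for the rank, uniform in \<open>w\<close>. That the \<open>w i\<close> span
  V enters through the exterior factor, which must be rewritten in wedge products of the same
  vectors.\<close>

lemma koszul_flattening_lin_prod_mem:
  assumes w: "\<And>i. i \<in> {1..n} \<Longrightarrow> w i \<in> base_space n"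
    and e: "\<And>i. i \<in> {1..n} \<Longrightarrow> basis_vec i \<in> cvs.span (w ` {1..n})"
    and v: "v \<in> koszul_dom n k p"
  shows "koszul_flattening (lin_prod w {1..n}) v \<in> cvs.span (good_gens w n (n - k) p)"
  using v unfolding koszul_dom_span
proof (rule span_linear_image[rotated 3])
  fix x :: "expo \<times> nat set \<Rightarrow>\<^sub>0 complex"
  assume "x \<in> basis_vec ` (exps n k \<times> subsets n p)"
  then obtain a I where x: "x = basis_vec (a, I)" and a: "a \<in> exps n k" and I: "I \<in> subsets n p"
    by auto
  define R where "R = (\<lambda>(B, I). tensor (lin_prod w B) (wedge_prod w I)) ` (subsets n (n - k) \<times> subsets n p)"
  have "partials a (lin_prod w {1..n}) \<in> cvs.span (lin_prod w ` subsets n (n - k))"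
    using partials_lin_prod_mem[of a w n] a by (simp add: exps_def)
  moreover have "basis_vec I \<in> cvs.span (wedge_prod w ` subsets n p)"
    by (rule subsetD[OF ext_power_span_wedge_prod[OF w e]])
      (use I in \<open>auto simp: ext_power_def subsets_def\<close>)
  ultimately have "tensor (partials a (lin_prod w {1..n})) (basis_vec I) \<in> cvs.span R"
    by (rule tensor_span) (auto simp: R_def intro!: cvs.span_base)
  then have "ext_deriv (tensor (partials a (lin_prod w {1..n})) (basis_vec I))
      \<in> cvs.span (good_gens w n (n - k) p)"
  proof (rule span_linear_image[rotated 3])
    fix y assume "y \<in> R"
    then obtain B I where "B \<in> subsets n (n - k)" "I \<in> subsets n p" "ext_deriv y = koszul_gen w B I"
      by (auto simp: R_def koszul_gen_def)
    then show "ext_deriv y \<in> cvs.span (good_gens w n (n - k) p)"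
      using koszul_gen_mem_span_good_gens[OF w] by auto
  qed (simp_all add: ext_deriv_add ext_deriv_cscale)
  then show "koszul_flattening (lin_prod w {1..n}) x \<in> cvs.span (good_gens w n (n - k) p)"
    by (simp add: x koszul_flattening_basis_vec)
qed (simp_all add: koszul_flattening_add koszul_flattening_cscale)

section \<open>Counting\<close>

text \<open>A pair is determined by T = \<open>B \<inter> I\<close>, the symmetric difference U and
  J = \<open>I - B\<close>. With s = |T| one has |U| = d - k + p - 2s and |J| = p - s, and goodness
  says that J avoids \<open>Min U\<close>.\<close>

lemma card_good_pairs:
  assumes "k < d" "p < d"
  shows "card (good_pairs d (d - k) p) = S_rank p d k"
proof -
  define Y where "Y s = (SIGMA T:subsets d s.
      (SIGMA U:{U. U \<subseteq> {1..d} - T \<and> card U = d - k + p - 2 * s}.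
        {J. J \<subseteq> U - {Min U} \<and> card J = p - s}))" for s
  define X where "X = (SIGMA s:{max 0 (p - k)..min p (d - k - 1)}. Y s)"
  have fin_J: "finite {J. J \<subseteq> U - {Min U} \<and> card J = q}" if "U \<subseteq> {1..d} - T" for U T q
    by (rule finite_subset[of _ "Pow {1..d}"]) (use that in auto)
  have fin_U: "finite {U. U \<subseteq> {1..d} - T \<and> card U = q}" for T q
    by (rule finite_subset[of _ "Pow {1..d}"]) auto
  have fin_UJ: "finite (SIGMA U:{U. U \<subseteq> {1..d} - T \<and> card U = q}.
        {J. J \<subseteq> U - {Min U} \<and> card J = r})" for T q r
    by (rule finite_SigmaI[OF fin_U]) (use fin_J in blast)
  have fin: "finite (Y s)" for s
    unfolding Y_def by (intro finite_SigmaI finite_subsets fin_UJ)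
  have cardY: "card (Y s) = (d choose s) * ((d - s) choose (d - k + p - 2 * s)) *
     ((d - k + p - 2 * s - 1) choose (p - s))" if s: "s \<in> {max 0 (p - k)..min p (d - k - 1)}" for s
  proof -
    let ?m = "d - k + p - 2 * s"
    \<comment> \<open>Here s \<le> p and s < d - k, so U is nonempty and \<open>Min U\<close> is a
      genuine element to be left out.\<close>
    have m: "?m > 0" using s assms by auto
    have 1: "card {J. J \<subseteq> U - {Min U} \<and> card J = p - s} = (?m - 1) choose (p - s)"
      if "U \<subseteq> {1..d} - T" "card U = ?m" for U T :: "nat set"
    proof -
      have "finite U" "U \<noteq> {}" using that m by (auto intro: finite_subset)
      then have "card (U - {Min U}) = ?m - 1" using that by simp
      then show ?thesis using \<open>finite U\<close> by (simp add: n_subsets)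
    qed
    have 2: "card {U. U \<subseteq> {1..d} - T \<and> card U = ?m} = ((d - s) choose ?m)" if "T \<in> subsets d s" for T
    proof -
      have "card ({1..d} - T) = d - s" using that by (auto simp: subsets_def card_Diff_subset finite_subset)
      then show ?thesis by (simp add: n_subsets)
    qed
    have 3: "card (subsets d s) = d choose s" unfolding subsets_def by (simp add: n_subsets)
    have inner: "card (SIGMA U:{U. U \<subseteq> {1..d} - T \<and> card U = ?m}.
        {J. J \<subseteq> U - {Min U} \<and> card J = p - s}) = ((d - s) choose ?m) * ((?m - 1) choose (p - s))"
      if "T \<in> subsets d s" for T
    proof -
      have "card (SIGMA U:{U. U \<subseteq> {1..d} - T \<and> card U = ?m}.
          {J. J \<subseteq> U - {Min U} \<and> card J = p - s})
        = (\<Sum>U\<in>{U. U \<subseteq> {1..d} - T \<and> card U = ?m}. card {J. J \<subseteq> U - {Min U} \<and> card J = p - s})"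
        by (rule card_SigmaI[OF fin_U]) (use fin_J in blast)
      also have "\<dots> = (\<Sum>U\<in>{U. U \<subseteq> {1..d} - T \<and> card U = ?m}. (?m - 1) choose (p - s))"
        by (intro sum.cong refl 1) auto
      finally show ?thesis using 2[OF that] by simp
    qed
    have "card (Y s) = (\<Sum>T\<in>subsets d s. card (SIGMA U:{U. U \<subseteq> {1..d} - T \<and> card U = ?m}.
          {J. J \<subseteq> U - {Min U} \<and> card J = p - s}))"
      unfolding Y_def
      by (intro card_SigmaI finite_subsets ballI fin_UJ)
    also have "\<dots> = (\<Sum>T\<in>subsets d s. ((d - s) choose ?m) * ((?m - 1) choose (p - s)))"
      by (intro sum.cong refl inner)
    finally show ?thesis using 3 by (simp add: mult.assoc)
  qed
  have "card X = (\<Sum>s\<in>{max 0 (p - k)..min p (d - k - 1)}. card (Y s))"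
    unfolding X_def by (rule card_SigmaI) (auto simp: fin)
  also have "\<dots> = S_rank p d k"
    unfolding S_rank_def by (intro sum.cong refl cardY)
  finally have cardX: "card X = S_rank p d k" .
  \<comment> \<open>\<open>g\<close> reads off s, T, U and J; \<open>f\<close> rebuilds the pair,
    splitting U into J, which goes to \<open>I\<close>, and the rest, which goes to
    \<open>B\<close>.\<close>
  define f where "f = (\<lambda>(s :: nat, T :: nat set, U, J). (T \<union> (U - J), T \<union> J))"
  define g where "g = (\<lambda>(B :: nat set, I). (card (B \<inter> I), B \<inter> I, sym_diff B I, I - B))"
  have "bij_betw g (good_pairs d (d - k) p) X"
  proof (rule bij_betw_byWitness[where f' = f])
    show "\<forall>x\<in>good_pairs d (d - k) p. f (g x) = x"
      by (auto simp: f_def g_def)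
    have X: "T \<subseteq> {1..d} \<and> card T = s \<and> U \<subseteq> {1..d} \<and> T \<inter> U = {} \<and> card U = d - k + p - 2 * s \<and>
        J \<subseteq> U \<and> Min U \<notin> J \<and> card J = p - s \<and> p - k \<le> s \<and> s \<le> p \<and> s \<le> d - k - 1"
      if "(s, T, U, J) \<in> X" for s T U J
      using that by (auto simp: X_def Y_def subsets_def)
    show "\<forall>x\<in>X. g (f x) = x"
    proof
      fix x assume "x \<in> X"
      obtain s T U J where x: "x = (s, T, U, J)" by (cases x)
      note * = X[of s T U J, OF \<open>x \<in> X\<close>[unfolded x]]
      have "(T \<union> (U - J)) \<inter> (T \<union> J) = T" "(T \<union> J) - (T \<union> (U - J)) = J"
        "sym_diff (T \<union> (U - J)) (T \<union> J) = U"
        using * by auto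
      then show "g (f x) = x" using * by (simp add: x f_def g_def)
    qed
    show "f ` X \<subseteq> good_pairs d (d - k) p"
    proof
      fix y assume "y \<in> f ` X"
      then obtain s T U J where x: "(s, T, U, J) \<in> X" and y: "y = (T \<union> (U - J), T \<union> J)"
        by (auto simp: f_def)
      note * = X[OF x]
      have fin: "finite T" "finite U" using * by (auto intro: finite_subset)
      then have finJ: "finite J" using * by (blast intro: finite_subset)
      have U: "U \<noteq> {}" using * assms by auto
      have "card (T \<union> (U - J)) = s + (card U - card J)"
        using * fin finJ by (subst card_Un_disjoint) (auto simp: card_Diff_subset)
      also have "\<dots> = d - k" using * assms by auto
      finally have 1: "card (T \<union> (U - J)) = d - k" .
      have 2: "card (T \<union> J) = p"
        using * fin finJ by (subst card_Un_disjoint) auto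
      have 3: "sym_diff (T \<union> (U - J)) (T \<union> J) = U" using * by auto
      have 4: "Min U \<in> T \<union> (U - J)" using Min_in[OF fin(2) U] * by auto
      show "y \<in> good_pairs d (d - k) p"
        using * 1 2 3 4 U by (auto simp: y good_pairs_def subsets_def)
    qed
    show "g ` good_pairs d (d - k) p \<subseteq> X"
    proof
      fix y assume "y \<in> g ` good_pairs d (d - k) p"
      then obtain B I where BI: "(B, I) \<in> good_pairs d (d - k) p"
        and y: "y = (card (B \<inter> I), B \<inter> I, sym_diff B I, I - B)"
        by (auto simp: g_def)
      let ?U = "sym_diff B I" and ?s = "card (B \<inter> I)"
      from BI have sub: "B \<subseteq> {1..d}" "I \<subseteq> {1..d}" and card: "card B = d - k" "card I = p"
        and U: "?U \<noteq> {}" "Min ?U \<in> B"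
        by (auto simp: good_pairs_def subsets_def)
      have fin: "finite B" "finite I" using sub by (auto intro: finite_subset)
      then have finU: "finite ?U" by simp
      have cB: "card B = ?s + card (B - I)" and cI: "card I = ?s + card (I - B)"
        using fin card_Int_Diff[of B I] card_Int_Diff[of I B] by (auto simp: Int_commute)
      have MU: "Min ?U \<in> B - I" using Min_in[OF finU U(1)] U(2) by auto
      \<comment> \<open>The vertex lies in \<open>B - I\<close>, so s is strictly below |B|: this
        gives the upper limit d - k - 1 of the sum.\<close>
      then have pos: "card (B - I) > 0" using fin by (auto simp: card_gt_0_iff)
      have cU: "card ?U = card (B - I) + card (I - B)"
        using fin by (intro card_Un_disjoint) auto
      have "card (B \<union> I) = ?s + card ?U"
      proof -
        have "B \<union> I = (B \<inter> I) \<union> ?U" by auto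
        then show ?thesis using fin finU by (simp, subst card_Un_disjoint) auto
      qed
      moreover have "card (B \<union> I) \<le> d" using card_mono[of "{1..d}" "B \<union> I"] sub by simp
      \<comment> \<open>The union of \<open>B\<close> and \<open>I\<close> has d - k + p - s
        elements and must fit into d: this gives the lower limit p - k of the sum.\<close>
      ultimately have le: "?s + card ?U \<le> d" by simp
      have "?s \<in> {max 0 (p - k)..min p (d - k - 1)}"
        using le cU cB cI card pos assms by auto
      moreover have "B \<inter> I \<in> subsets d ?s" using sub by (auto simp: subsets_def)
      moreover have "?U \<subseteq> {1..d} - B \<inter> I" using sub by auto
      moreover have "card ?U = d - k + p - 2 * ?s" using cU cB cI card by simp
      moreover have "I - B \<subseteq> ?U - {Min ?U}" using MU by auto
      moreover have "card (I - B) = p - ?s" using cI card by simp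
      ultimately show "y \<in> X" by (auto simp: y X_def Y_def)
    qed
  qed
  then show ?thesis using cardX by (simp add: bij_betw_same_card)
qed

section \<open>The rank\<close>

text \<open>Each vector has a coordinate of its own, nonzero there and zero in all other vectors, so
  any linear relation can be tested at that coordinate.\<close>

lemma independent_by_lookup:
  assumes fin: "finite G"
    and nz: "\<And>x. x \<in> G \<Longrightarrow> Poly_Mapping.lookup (f x) (\<phi> x) \<noteq> 0"
    and z: "\<And>x y. x \<in> G \<Longrightarrow> y \<in> G \<Longrightarrow> y \<noteq> x \<Longrightarrow> Poly_Mapping.lookup (f y) (\<phi> x) = 0"
  shows "inj_on f G" and "cvs.independent (f ` G)"
proof -
  show inj: "inj_on f G"
    using nz z by (metis inj_onI)
  show "cvs.independent (f ` G)"
  proof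
    assume "cvs.dependent (f ` G)"
    then obtain u x where u: "x \<in> G" "u (f x) \<noteq> 0" "(\<Sum>v\<in>f ` G. cscale (u v) v) = 0"
      using fin by (auto simp: cvs.dependent_finite)
    have "0 = (\<Sum>y\<in>G. u (f y) * Poly_Mapping.lookup (f y) (\<phi> x))"
      using arg_cong[OF u(3), of "\<lambda>v. Poly_Mapping.lookup v (\<phi> x)"]
      by (simp add: sum.reindex[OF inj] lookup_sum)
    also have "\<dots> = (\<Sum>y\<in>{x}. u (f y) * Poly_Mapping.lookup (f y) (\<phi> x))"
      using fin u(1) z by (intro sum.mono_neutral_right) auto
    finally show False using u nz by simp
  qed
qed

section \<open>Squarefree monomials and independence of the good generators\<close>

definition sqfree :: "nat set \<Rightarrow> expo" where
  "sqfree B = (\<Sum>i\<in>B. Poly_Mapping.single i 1)"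

lemma lookup_sqfree: "finite B \<Longrightarrow> Poly_Mapping.lookup (sqfree B) i = (if i \<in> B then 1 else 0)"
  by (simp add: sqfree_def lookup_sum lookup_single when_def sum.delta)

lemma keys_sqfree: "finite B \<Longrightarrow> Poly_Mapping.keys (sqfree B) = B"
  by (auto simp: in_keys_iff lookup_sqfree split: if_splits)

lemma sqfree_eq_iff: "finite B \<Longrightarrow> finite C \<Longrightarrow> sqfree B = sqfree C \<longleftrightarrow> B = C"
  by (metis keys_sqfree)

lemma lin_form_basis_vec: "lin_form (basis_vec i) = basis_vec (Poly_Mapping.single i 1)"
  by (simp add: lin_form_def)

lemma lin_prod_basis_vec: "finite B \<Longrightarrow> lin_prod basis_vec B = basis_vec (sqfree B)"
  by (induction B rule: finite_induct)
    (simp_all add: lin_prod_def sqfree_def basis_vec_zero lin_form_basis_vec basis_vec_mult)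

lemma partial_lin_prod_basis_vec:
  assumes "finite B" "i \<in> B"
  shows "partial i (lin_prod basis_vec B) = lin_prod basis_vec (B - {i})"
proof -
  have "partial i (lin_prod basis_vec B) =
      (\<Sum>j\<in>B. if j = i then lin_prod basis_vec (B - {j}) else 0)"
    unfolding partial_lin_prod[OF assms(1)]
    by (intro sum.cong) (auto simp: basis_vec_def lookup_single)
  then show ?thesis using assms by (simp add: sum.delta)
qed

text \<open>Every variable is differentiated once and occurs once, so no numerical factor
  appears.\<close>

lemma partials_sqfree:
  assumes "finite B" "A \<subseteq> B"
  shows "partials (sqfree A) (lin_prod basis_vec B) = lin_prod basis_vec (B - A)"
proof -
  have fin: "finite A" using assms finite_subset by auto
  have "fold partial xs (lin_prod basis_vec B) = lin_prod basis_vec (B - set xs)"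
    if "distinct xs" "set xs \<subseteq> B" "finite B" for xs B
    using that
  proof (induction xs arbitrary: B)
    case (Cons x xs)
    then have "partial x (lin_prod basis_vec B) = lin_prod basis_vec (B - {x})"
      by (intro partial_lin_prod_basis_vec) auto
    moreover have "B - {x} - set xs = B - set (x # xs)" by auto
    ultimately show ?case using Cons.IH[of "B - {x}"] Cons.prems by auto
  qed simp
  moreover have "partials (sqfree A) f = fold partial (sorted_list_of_set A) f" for f
    unfolding partials_def using fin
    by (intro fold_cong) (auto simp: keys_sqfree lookup_sqfree)
  ultimately show ?thesis using assms fin by simp
qed

lemma sqfree_mem_exps: "A \<in> subsets n k \<Longrightarrow> sqfree A \<in> exps n k"
  using subsets_finite[of A n k]
  by (auto simp: exps_def keys_sqfree lookup_sqfree subsets_def)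

lemma basis_vec_mem_base_space: "i \<in> {1..n} \<Longrightarrow> basis_vec i \<in> base_space n"
  by (simp add: base_space_def)

lemma koszul_gen_basis_vec_mem_image:
  assumes "k \<le> n" and B: "B \<in> subsets n (n - k)" and I: "I \<in> subsets n p"
  shows "koszul_gen basis_vec B I \<in> koszul_flattening (lin_prod basis_vec {1..n}) ` koszul_dom n k p"
proof
  \<comment> \<open>Differentiating by the complement of \<open>B\<close> leaves exactly the
    monomial x_B.\<close>
  let ?A = "{1..n} - B"
  have "?A \<in> subsets n k"
    using assms subsets_finite[OF B] by (auto simp: subsets_def card_Diff_subset)
  then show "basis_vec (sqfree ?A, I) \<in> koszul_dom n k p"
    unfolding koszul_dom_span using I by (intro cvs.span_base imageI) (simp add: sqfree_mem_exps)
  have "{1..n} - ?A = B" using B by (auto simp: subsets_def)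
  then show "koszul_gen basis_vec B I = koszul_flattening (lin_prod basis_vec {1..n}) (basis_vec (sqfree ?A, I))"
    unfolding koszul_flattening_basis_vec koszul_gen_def
    using subsets_finite[OF I] by (subst partials_sqfree) (auto simp: wedge_prod_basis_vec)
qed

lemma lookup_koszul_gen_basis_vec:
  assumes B: "B \<in> subsets n b" and I: "I \<in> subsets n p" and "finite C"
  shows "Poly_Mapping.lookup (koszul_gen basis_vec B I) (sqfree C, J) =
    (\<Sum>j\<in>B - I. if B - {j} = C \<and> insert j I = J then sign_at I j else 0)"
proof -
  have fin: "finite B" "finite I" using B I subsets_finite by auto
  have "I \<subseteq> {1..n}" using I by (auto simp: subsets_def)
  from koszul_gen_expand[where w = basis_vec and n = n and B = B and I = I,
      OF basis_vec_mem_base_space fin(1) this]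
  have "koszul_gen basis_vec B I = (\<Sum>j\<in>B - I. cscale (sign_at I j)
      (tensor (lin_prod basis_vec (B - {j})) (wedge_prod basis_vec (insert j I))))" by blast
  also have "\<dots> = (\<Sum>j\<in>B - I. cscale (sign_at I j) (basis_vec (sqfree (B - {j}), insert j I)))"
    using fin by (intro sum.cong refl)
      (simp only: lin_prod_basis_vec wedge_prod_basis_vec finite_Diff finite_insert tensor_basis_vec)
  finally show ?thesis
    using fin \<open>finite C\<close>
    by (auto simp: lookup_sum basis_vec_def lookup_single when_def sqfree_eq_iff intro!: sum.cong)
qed

text \<open>The private coordinate of a good pair is the term that moves u, the least element of the
  symmetric difference. Moving an element preserves the symmetric difference, so another good pair
  with this term has the same u. Its second set lacks u while the term contains it, so u is what it
  moved, and the two pairs agree.\<close>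

lemma good_gens_basis_vec:
  "inj_on (\<lambda>(B, I). koszul_gen basis_vec B I) (good_pairs n b p)"
  "cvs.independent (good_gens basis_vec n b p)"
proof -
  define u where "u X = Min (sym_diff (fst X) (snd X))" for X :: "nat set \<times> nat set"
  define \<phi> where "\<phi> X = (sqfree (fst X - {u X}), insert (u X) (snd X))" for X
  define f where "f = (\<lambda>(B, I). koszul_gen basis_vec B I)"
  have uX: "u X \<in> fst X - snd X" and finX: "finite (fst X)" "finite (snd X)"
    and subs: "fst X \<in> subsets n b" "snd X \<in> subsets n p" if "X \<in> good_pairs n b p" for X
  proof -
    obtain B I where X: "X = (B, I)" by (cases X)
    have *: "B \<in> subsets n b" "I \<in> subsets n p" "sym_diff B I \<noteq> {}" "Min (sym_diff B I) \<in> B"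
      using that by (auto simp: X good_pairs_def)
    have fin: "finite B" "finite I" using * subsets_finite by auto
    then have "finite (sym_diff B I)" by simp
    from Min_in[OF this *(3)] *(4) show "u X \<in> fst X - snd X"
      by (auto simp: X u_def)
    show "finite (fst X)" "finite (snd X)" "fst X \<in> subsets n b" "snd X \<in> subsets n p"
      using fin * by (auto simp: X)
  qed
  have look: "Poly_Mapping.lookup (f Y) (\<phi> X) = (\<Sum>j\<in>fst Y - snd Y.
      if fst Y - {j} = fst X - {u X} \<and> insert j (snd Y) = insert (u X) (snd X)
      then sign_at (snd Y) j else 0)"
    if "X \<in> good_pairs n b p" "Y \<in> good_pairs n b p" for X Y
    unfolding f_def \<phi>_def case_prod_unfold
    using subs[OF that(2)] finX[OF that(1)] by (intro lookup_koszul_gen_basis_vec) auto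
  have "Poly_Mapping.lookup (f X) (\<phi> X) \<noteq> 0" if X: "X \<in> good_pairs n b p" for X
  proof -
    have "Poly_Mapping.lookup (f X) (\<phi> X) =
        (\<Sum>j\<in>fst X - snd X. if j = u X then sign_at (snd X) j else 0)"
      unfolding look[OF X X] using uX[OF X] by (intro sum.cong refl if_cong) auto
    then show ?thesis using uX[OF X] finX[OF X] by (simp add: sum.delta sign_at_def)
  qed
  moreover have "Poly_Mapping.lookup (f Y) (\<phi> X) = 0"
    if X: "X \<in> good_pairs n b p" and Y: "Y \<in> good_pairs n b p" and "Y \<noteq> X" for X Y
  proof -
    have "\<not> (fst Y - {j} = fst X - {u X} \<and> insert j (snd Y) = insert (u X) (snd X))"
      if j: "j \<in> fst Y - snd Y" for j
    proof
      assume *: "fst Y - {j} = fst X - {u X} \<and> insert j (snd Y) = insert (u X) (snd X)"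
      have inv: "sym_diff B I = sym_diff (B - {i}) (insert i I)" if "i \<in> B - I" for B I i
        using that by auto
      have "sym_diff (fst Y) (snd Y) = sym_diff (fst X) (snd X)"
        using inv[OF j] inv[OF uX[OF X]] * by metis
      then have "u Y = u X" by (simp add: u_def)
      have "j = u X"
        using * uX[OF Y] uX[OF X] \<open>u Y = u X\<close> by (metis DiffE insertE insertI1)
      then have "fst Y = fst X" "snd Y = snd X"
        using * j uX[OF X] by (metis DiffE insert_Diff, metis DiffE insert_ident)
      then show False using \<open>Y \<noteq> X\<close> by (simp add: prod_eq_iff)
    qed
    then show ?thesis unfolding look[OF X Y] by (intro sum.neutral) auto
  qed
  ultimately show "inj_on (\<lambda>(B, I). koszul_gen basis_vec B I) (good_pairs n b p)"
    "cvs.independent (good_gens basis_vec n b p)"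
    using independent_by_lookup[OF finite_good_pairs, of n b p f \<phi>] unfolding f_def by blast+
qed

lemma rank_koszul_flattening:
  assumes "k < d" "p < d"
  shows "rank_on (koszul_dom d k p) (koszul_flattening (lin_prod basis_vec {1..d})) = S_rank p d k"
  unfolding rank_on_def
proof (rule cvs.dim_unique)
  show "good_gens basis_vec d (d - k) p
      \<subseteq> koszul_flattening (lin_prod basis_vec {1..d}) ` koszul_dom d k p"
    using assms koszul_gen_basis_vec_mem_image[of k d] by (auto simp: good_pairs_def)
  show "koszul_flattening (lin_prod basis_vec {1..d}) ` koszul_dom d k p
      \<subseteq> cvs.span (good_gens basis_vec d (d - k) p)"
    by (intro image_subsetI koszul_flattening_lin_prod_mem basis_vec_mem_base_space)
      (auto intro: cvs.span_base)
  show "cvs.independent (good_gens basis_vec d (d - k) p)"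
    by (rule good_gens_basis_vec)
  show "card (good_gens basis_vec d (d - k) p) = S_rank p d k"
    using assms by (simp add: card_image good_gens_basis_vec card_good_pairs)
qed

text \<open>The identity holds term by term: writing m = d - k + p - 2s, the quotient of m! and (m -
  1)! leaves the denominator m. The right side is real because its single quotients need not be
  integers.\<close>

lemma S_rank_eq:
  assumes "k < d" "p < d"
  shows "real (S_rank p d k) = fact d / (fact p * fact (d - p - 1)) *
           (\<Sum>s = max 0 (p - k)..min p (d - k - 1).
              real (p choose s) * real ((d - 1 - p) choose (s + k - p)) / real (d - k + p - 2 * s))"
  unfolding S_rank_def of_nat_sum sum_distrib_left
proof (rule sum.cong[OF refl])
  fix s assume s: "s \<in> {max 0 (p - k)..min p (d - k - 1)}"
  define m where "m = d - k + p - 2 * s"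
  have m: "0 < m" "m \<le> d - s" "s \<le> d" "p - s \<le> m - 1" "s \<le> p" "s + k - p \<le> d - 1 - p"
    using s assms by (auto simp: m_def)
  \<comment> \<open>The last binomial on each side contributes the same factorial of d - k - s -
    1.\<close>
  have e: "d - s - m = s + k - p" "m - 1 - (p - s) = d - k - s - 1"
    "d - 1 - p - (s + k - p) = d - k - s - 1" "d - p - 1 = d - 1 - p"
    using s assms by (auto simp: m_def)
  have f: "(fact m :: real) = real m * fact (m - 1)" using m(1) by (simp add: fact_reduce)
  have "real ((d choose s) * ((d - s) choose m) * ((m - 1) choose (p - s))) =
      fact d / (fact p * fact (d - p - 1)) *
      (real (p choose s) * real ((d - 1 - p) choose (s + k - p)) / real m)"
    unfolding of_nat_mult binomial_fact[OF m(2)] binomial_fact[OF m(3)] binomial_fact[OF m(4)]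
      binomial_fact[OF m(5)] binomial_fact[OF m(6)] e f
    using m(1) by (simp add: divide_simps)
  then show "real ((d choose s) * ((d - s) choose (d - k + p - 2 * s)) *
        ((d - k + p - 2 * s - 1) choose (p - s))) =
      fact d / (fact p * fact (d - p - 1)) *
      (real (p choose s) * real ((d - 1 - p) choose (s + k - p)) / real (d - k + p - 2 * s))"
    by (simp only: m_def)
qed

section \<open>The codomain\<close>

lemma exps_add: "a \<in> exps n i \<Longrightarrow> b \<in> exps n j \<Longrightarrow> a + b \<in> exps n (i + j)"
  using Poly_Mapping.keys_add[of a b] by (auto simp: exps_iff lookup_add sum.distrib)

lemma partial_mem_sym_power:
  assumes "f \<in> sym_power n j"
  shows "partial i f \<in> sym_power n (j - 1)"
  using assms unfolding sym_power_span
proof (rule span_linear_image[rotated 3])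
  fix x :: mpoly assume "x \<in> basis_vec ` exps n j"
  then obtain a where x: "x = basis_vec a" and a: "a \<in> exps n j" by auto
  show "partial i x \<in> cvs.span (basis_vec ` exps n (j - 1))"
  proof (cases "i \<in> Poly_Mapping.keys a")
    case True
    let ?e = "Poly_Mapping.single i (1::nat)"
    \<comment> \<open>The subtraction of exponents is truncated; it is exact here because
      \<open>i\<close> occurs in \<open>a\<close>.\<close>
    have sub: "a = (a - ?e) + ?e"
      using True by (intro poly_mapping_eqI) (auto simp: lookup_add lookup_minus lookup_single when_def in_keys_iff)
    have i: "i \<in> {1..n}" and keys: "Poly_Mapping.keys a \<subseteq> {1..n}" using True a by (auto simp: exps_iff)
    have "Poly_Mapping.keys (a - ?e) \<subseteq> {1..n}"
      using keys by (auto simp: in_keys_iff lookup_minus subset_iff)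
    moreover have "(\<Sum>l=1..n. Poly_Mapping.lookup a l) =
        (\<Sum>l=1..n. Poly_Mapping.lookup (a - ?e) l) + (\<Sum>l=1..n. Poly_Mapping.lookup ?e l)"
      unfolding sum.distrib[symmetric] lookup_add[symmetric] sub[symmetric] ..
    moreover have "(\<Sum>l=1..n. Poly_Mapping.lookup ?e l) = 1"
      using i by (simp add: lookup_single when_def sum.delta)
    ultimately have "a - ?e \<in> exps n (j - 1)" using a by (auto simp: exps_iff)
    then show ?thesis
      by (simp add: x partial_def cvs.span_scale cvs.span_base)
  qed (simp add: x partial_basis_notin cvs.span_zero)
qed (simp_all add: partial_add partial_cscale)

lemma ext_deriv_mem_tensor_space:
  assumes f: "f \<in> sym_power n j" and \<omega>: "\<omega> \<in> ext_power n p"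
  shows "ext_deriv (tensor f \<omega>) \<in> tensor_space (sym_power n (j - 1)) (ext_power n (p + 1))"
proof -
  have "ext_deriv (tensor f \<omega>) = (\<Sum>i=1..n. tensor (partial i f) (wedge (basis_vec i) \<omega>))"
    by (rule ext_deriv_tensor) (use f in \<open>auto simp: sym_power_def\<close>)
  also have "\<dots> \<in> tensor_space (sym_power n (j - 1)) (ext_power n (p + 1))"
    unfolding tensor_space_def
  proof (intro cvs.span_sum cvs.span_base)
    fix i assume "i \<in> {1..n}"
    then have "wedge (basis_vec i) \<omega> \<in> ext_power n (p + 1)"
      using wedge_mem_ext_power[OF basis_vec_mem_base_space \<omega>] by simp
    then show "tensor (partial i f) (wedge (basis_vec i) \<omega>)
        \<in> {tensor v w | v w. v \<in> sym_power n (j - 1) \<and> w \<in> ext_power n (p + 1)}"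
      using partial_mem_sym_power[OF f] by blast
  qed
  finally show ?thesis .
qed

lemma sym_power_mult:
  assumes f: "f \<in> sym_power n i" and g: "g \<in> sym_power n j"
  shows "f * g \<in> sym_power n (i + j)"
  using f unfolding sym_power_span[of n i] sym_power_span[of n "i + j"]
proof (rule span_linear_image[where f = "\<lambda>f. f * g", rotated 3])
  fix x :: mpoly assume "x \<in> basis_vec ` exps n i"
  then obtain a where x: "x = basis_vec a" and a: "a \<in> exps n i" by auto
  show "x * g \<in> cvs.span (basis_vec ` exps n (i + j))"
    using g unfolding sym_power_span
  proof (rule span_linear_image[rotated 3])
    fix y :: mpoly assume "y \<in> basis_vec ` exps n j"
    then show "x * y \<in> cvs.span (basis_vec ` exps n (i + j))"
      using a by (auto simp: x basis_vec_mult intro!: cvs.span_base imageI exps_add)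
  qed (simp_all add: distrib_left cscale_mult_right)
qed (simp_all add: distrib_right cscale_mult_left)

lemma lin_form_add: "lin_form (v + w) = lin_form v + lin_form w"
  and lin_form_cscale: "lin_form (cscale c v) = cscale c (lin_form v)"
  by (simp_all add: lin_form_def lin_ext_add lin_ext_cscale)

lemma lin_form_mem_sym_power:
  assumes "v \<in> base_space n"
  shows "lin_form v \<in> sym_power n 1"
  using assms unfolding base_space_span sym_power_span
proof (rule span_linear_image[rotated 3])
  fix x :: "nat \<Rightarrow>\<^sub>0 complex" assume "x \<in> basis_vec ` {1..n}"
  then show "lin_form x \<in> cvs.span (basis_vec ` exps n 1)"
    by (auto simp: lin_form_basis_vec exps_def intro!: cvs.span_base imageI)
qed (simp_all add: lin_form_add lin_form_cscale)

lemma lin_prod_mem_sym_power: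
  assumes "finite B" "\<And>i. i \<in> B \<Longrightarrow> w i \<in> base_space n"
  shows "lin_prod w B \<in> sym_power n (card B)"
  using assms
proof (induction B rule: finite_induct)
  case empty
  have "0 \<in> exps n 0" by (simp add: exps_def)
  then have "basis_vec 0 \<in> sym_power n 0"
    unfolding sym_power_span by (intro cvs.span_base imageI)
  then show ?case by (simp add: lin_prod_def basis_vec_zero)
next
  case (insert x B)
  then have "lin_form (w x) * lin_prod w B \<in> sym_power n (1 + card B)"
    by (intro sym_power_mult lin_form_mem_sym_power) auto
  then show ?case using insert by (simp add: lin_prod_def)
qed

lemma koszul_gen_mem_cod:
  assumes w: "\<And>i. i \<in> {1..n} \<Longrightarrow> w i \<in> base_space n"
    and B: "B \<in> subsets n (d - k)" and I: "I \<in> subsets n p"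
  shows "koszul_gen w B I \<in> koszul_cod n d k p"
  unfolding koszul_gen_def koszul_cod_def
proof (rule ext_deriv_mem_tensor_space)
  show "lin_prod w B \<in> sym_power n (d - k)"
    using lin_prod_mem_sym_power[OF subsets_finite[OF B], of w n] B w
    by (auto simp: subsets_def subset_iff)
  show "wedge_prod w I \<in> ext_power n p"
    using wedge_list_mem_ext_power[of "sorted_list_of_set I" w n] I w subsets_finite[OF I]
    by (auto simp: subsets_def subset_iff)
qed

text \<open>\<open>cvs.representation C\<close> is linear only on the span of \<open>C\<close>. The
  entries of the matrix are therefore linear in \<open>Q\<close> once all values are known to lie in
  the codomain.\<close>

lemma koszul_flattening_mem_cod:
  assumes Q: "Q \<in> sym_power n d" and v: "v \<in> koszul_dom n k p"
  shows "koszul_flattening Q v \<in> koszul_cod n d k p"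
proof -
  have "koszul_flattening Q v \<in> cvs.span (koszul_cod n d k p)"
    using v unfolding koszul_dom_span
  proof (rule span_linear_image[rotated 3])
    fix x :: "expo \<times> nat set \<Rightarrow>\<^sub>0 complex"
    assume "x \<in> basis_vec ` (exps n k \<times> subsets n p)"
    then obtain a I where x: "x = basis_vec (a, I)" and a: "a \<in> exps n k" and I: "I \<in> subsets n p"
      by auto
    have "partials a Q \<in> sym_power n (d - k)"
      using partials_mem_graded[where X = "sym_power n" and m = d, OF partial_mem_sym_power Q, of a] a
      by (simp add: exps_def)
    moreover have "basis_vec I \<in> ext_power n p"
      using I by (simp add: ext_power_def subsets_def)
    ultimately show "koszul_flattening Q x \<in> cvs.span (koszul_cod n d k p)"
      unfolding x koszul_flattening_basis_vec koszul_cod_def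
      by (intro cvs.span_base ext_deriv_mem_tensor_space)
  qed (simp_all add: koszul_flattening_add koszul_flattening_cscale)
  then show ?thesis unfolding koszul_cod_def tensor_space_def cvs.span_span .
qed

section \<open>Vanishing of the minors\<close>

lemma det_zero_row:
  fixes A :: "complex mat"
  assumes "A \<in> carrier_mat n n" "r < n" "\<And>j. j < n \<Longrightarrow> A $$ (r, j) = 0"
  shows "det A = 0"
proof -
  have "(\<Prod>i = 0..<n. A $$ (i, q i)) = 0" if "q permutes {0..<n}" for q
    using assms permutes_in_image[OF that, of r] by (intro prod_zero) (auto intro!: bexI[of _ r])
  then show ?thesis unfolding det_def'[OF assms(1)] by (intro sum.neutral) auto
qed

text \<open>The coordinate matrix factors through a space of dimension \<open>card G\<close> <
  \<open>n\<close>. Padding both factors with zeros to square matrices lets multiplicativity of the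
  determinant finish the proof.\<close>

lemma det_representation_zero:
  assumes G: "finite G" "card G < n" "G \<subseteq> cvs.span C" and C: "cvs.independent C"
    and y: "\<And>j. j < n \<Longrightarrow> y j \<in> cvs.span G"
  shows "det (mat n n (\<lambda>(i, j). cvs.representation C (y j) (c i))) = 0"
proof -
  obtain gs where gs: "set gs = G" "distinct gs"
    using finite_distinct_list[OF G(1)] by auto
  have len: "length gs = card G" using gs distinct_card by fastforce
  have "\<exists>u. \<forall>j<n. y j = (\<Sum>g\<in>G. cscale (u j g) g)"
    using y unfolding cvs.span_finite[OF G(1)] by (intro choice) (auto simp: image_iff)
  then obtain u where u: "\<And>j. j < n \<Longrightarrow> y j = (\<Sum>g\<in>G. cscale (u j g) g)" by blast
  define R where "R = mat n n (\<lambda>(i, l). if l < length gs then cvs.representation C (gs ! l) (c i) else 0)"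
  define X where "X = mat n n (\<lambda>(l, j). if l < length gs then u j (gs ! l) else 0)"
  have "mat n n (\<lambda>(i, j). cvs.representation C (y j) (c i)) = R * X"
  proof (rule eq_matI)
    fix i j assume "i < dim_row (R * X)" "j < dim_col (R * X)"
    then have ij: "i < n" "j < n" by (auto simp: R_def X_def)
    have sp: "g \<in> cvs.span C" if "g \<in> G" for g using G(3) that by auto
    have "cvs.representation C (y j) (c i) = (\<Sum>g\<in>G. u j g * cvs.representation C g (c i))"
      unfolding u[OF ij(2)]
      by (subst cvs.representation_sum[OF C])
        (auto intro: cvs.span_scale sp simp: cvs.representation_scale[OF C sp])
    also have "\<dots> = (\<Sum>l<length gs. u j (gs ! l) * cvs.representation C (gs ! l) (c i))"
      using gs by (intro sum.reindex_bij_betw[symmetric]) (auto intro: bij_betw_nth)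
    also have "\<dots> = (\<Sum>l\<in>{0..<n}. if l < length gs then
        u j (gs ! l) * cvs.representation C (gs ! l) (c i) else 0)"
      using len G(2) by (intro sum.mono_neutral_cong_left) auto
    also have "\<dots> = (R * X) $$ (i, j)"
      using ij by (auto simp: R_def X_def scalar_prod_def intro!: sum.cong)
    finally show "mat n n (\<lambda>(i, j). cvs.representation C (y j) (c i)) $$ (i, j) = (R * X) $$ (i, j)"
      using ij by simp
  qed (auto simp: R_def X_def)
  \<comment> \<open>Row \<open>card G\<close> is the first row of padding.\<close>
  moreover have "det X = 0"
    by (rule det_zero_row[of _ n "card G"]) (use G len in \<open>auto simp: X_def\<close>)
  ultimately show ?thesis
    using det_mult[of R n X] by (simp add: R_def X_def)
qed

lemma koszul_minor_lin_prod_zero: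
  assumes kp: "k < d" "p < d"
    and w: "\<And>i. i \<in> {1..d} \<Longrightarrow> w i \<in> base_space d"
    and e: "\<And>i. i \<in> {1..d} \<Longrightarrow> basis_vec i \<in> cvs.span (w ` {1..d})"
    and C: "is_basis_of C (koszul_cod d d k p)"
    and bs: "set bs \<subseteq> koszul_dom d k p" "length bs = S_rank p d k + 1"
    and cs: "length cs = S_rank p d k + 1"
  shows "koszul_minor C bs cs (lin_prod w {1..d}) = 0"
  unfolding koszul_minor_def bs(2) cs
proof (rule det_representation_zero)
  show "finite (good_gens w d (d - k) p)" by (simp add: finite_good_pairs)
  \<comment> \<open>For general \<open>w\<close> only an upper bound on the number of generators is
    claimed.\<close>
  have "card (good_gens w d (d - k) p) \<le> card (good_pairs d (d - k) p)"
    by (rule card_image_le) (rule finite_good_pairs)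
  then show "card (good_gens w d (d - k) p) < S_rank p d k + 1"
    using kp by (simp add: card_good_pairs)
  show "good_gens w d (d - k) p \<subseteq> cvs.span C"
    using koszul_gen_mem_cod[OF w] C by (auto simp: good_pairs_def is_basis_of_def)
  show "cvs.independent C" using C by (simp add: is_basis_of_def)
  fix j assume "j < S_rank p d k + 1"
  then have "bs ! j \<in> koszul_dom d k p" using bs by (metis nth_mem subsetD)
  then show "koszul_flattening (lin_prod w {1..d}) (bs ! j) \<in> cvs.span (good_gens w d (d - k) p)"
    using koszul_flattening_lin_prod_mem[OF w e] by blast
qed

section \<open>Polynomial functions along a line\<close>

lemma poly_fun_sum:
  assumes "finite A" "\<And>x. x \<in> A \<Longrightarrow> poly_fun W (f x)"
  shows "poly_fun W (\<lambda>v. \<Sum>x\<in>A. f x v)"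
  using assms by (induction A rule: finite_induct) (auto intro: poly_fun.intros)

lemma poly_fun_prod:
  assumes "finite A" "\<And>x. x \<in> A \<Longrightarrow> poly_fun W (f x)"
  shows "poly_fun W (\<lambda>v. \<Prod>x\<in>A. f x v)"
  using assms by (induction A rule: finite_induct) (auto intro: poly_fun.intros)

text \<open>In the Leibniz expansion each entry is linear in \<open>Q\<close>, so the minor is built
  from linear functions by sums and products.\<close>

lemma poly_fun_koszul_minor:
  assumes C: "is_basis_of C (koszul_cod n d k p)" and bs: "set bs \<subseteq> koszul_dom n k p"
    and len: "length bs = length cs"
  shows "poly_fun (sym_power n d) (koszul_minor C bs cs)"
proof -
  let ?m = "length cs"
  have ind: "cvs.independent C" and sp: "cvs.span C = koszul_cod n d k p"
    using C by (auto simp: is_basis_of_def)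
  have entry: "poly_fun (sym_power n d) (\<lambda>Q. cvs.representation C (koszul_flattening Q b) c)"
    if b: "b \<in> koszul_dom n k p" for b c
    by (rule poly_fun.linear)
      (simp_all add: koszul_flattening_add_left koszul_flattening_cscale_left sp
        cvs.representation_add[OF ind] cvs.representation_scale[OF ind] koszul_flattening_mem_cod[OF _ b])
  have "koszul_minor C bs cs = (\<lambda>Q. \<Sum>q\<in>{q. q permutes {0..<?m}}.
      signof q * (\<Prod>i = 0..<?m. cvs.representation C (koszul_flattening Q (bs ! q i)) (cs ! i)))"
  proof
    fix Q
    show "koszul_minor C bs cs Q = (\<Sum>q\<in>{q. q permutes {0..<?m}}.
      signof q * (\<Prod>i = 0..<?m. cvs.representation C (koszul_flattening Q (bs ! q i)) (cs ! i)))"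
      unfolding koszul_minor_def len
      by (subst det_def'[of _ ?m])
        (auto intro!: sum.cong prod.cong arg_cong2[where f = "(*)"] dest: permutes_in_image)
  qed
  moreover have "poly_fun (sym_power n d) (\<lambda>Q. \<Sum>q\<in>{q. q permutes {0..<?m}}.
      signof q * (\<Prod>i = 0..<?m. cvs.representation C (koszul_flattening Q (bs ! q i)) (cs ! i)))"
  proof (intro poly_fun_sum poly_fun.mult poly_fun.const poly_fun_prod entry)
    fix q i assume "q \<in> {q. q permutes {0..<?m}}" "i \<in> {0..<?m}"
    then have "q i < length bs" using permutes_in_image[of q "{0..<?m}" i] len by auto
    then show "bs ! q i \<in> koszul_dom n k p" using bs by auto
  qed (simp_all add: finite_permutations)
  ultimately show ?thesis by simp
qed

text \<open>Linear functions become combinations of powers of t, and polynomials in t are closed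
  under sums and products. The curve stays in \<open>W\<close>, where alone a linear generator of
  \<open>poly_fun\<close> is required to be linear.\<close>

lemma poly_fun_curve:
  assumes "poly_fun W f" and W: "cvs.subspace W"
    and S: "finite S" "\<And>x. x \<in> S \<Longrightarrow> q x \<in> W"
  shows "\<exists>g. \<forall>t. f (\<Sum>x\<in>S. cscale (t ^ e x) (q x)) = poly g t"
  using assms(1)
proof induction
  case (linear f)
  have "f (cscale 0 0) = 0 * f 0" by (rule linear(2)) (rule cvs.subspace_0[OF W])
  then have f0: "f 0 = 0" by simp
  have "f (\<Sum>x\<in>S. cscale (t ^ e x) (q x)) = (\<Sum>x\<in>S. t ^ e x * f (q x))" for t
    using S
  proof (induction S rule: finite_induct)
    case (insert x S)
    have "(\<Sum>x\<in>S. cscale (t ^ e x) (q x)) \<in> W"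
      using insert by (intro cvs.subspace_sum cvs.subspace_scale W) auto
    then show ?case
      using insert by (simp add: linear cvs.subspace_scale[OF W])
  qed (simp add: f0)
  then have "\<forall>t. f (\<Sum>x\<in>S. cscale (t ^ e x) (q x)) = poly (\<Sum>x\<in>S. monom (f (q x)) (e x)) t"
    by (simp add: poly_sum poly_monom mult.commute)
  then show ?case by blast
next
  case (const c)
  show ?case by (rule exI[of _ "[:c:]"]) simp
next
  case (add f g)
  then show ?case by (metis poly_add)
next
  case (mult f g)
  then show ?case by (metis poly_mult)
qed

lemma prod_cscale: "finite A \<Longrightarrow> (\<Prod>x\<in>A. cscale c (f x :: mpoly)) = cscale (c ^ card A) (\<Prod>x\<in>A. f x)"
  by (induction A rule: finite_induct)
    (simp_all add: cscale_mult_left cscale_mult_right mult.commute)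

text \<open>\<open>X\<close> is the set of factors contributing \<open>w\<close>; the exponent of t
  counts the others.\<close>

lemma lin_prod_perturb:
  "lin_prod (\<lambda>i. w i + cscale t (u i)) {1..n} = (\<Sum>X\<in>Pow {1..n}.
     cscale (t ^ card ({1..n} - X)) (lin_prod w X * lin_prod u ({1..n} - X)))"
proof -
  have "lin_prod (\<lambda>i. w i + cscale t (u i)) {1..n} = (\<Sum>X\<in>Pow {1..n}.
      (\<Prod>i\<in>X. lin_form (w i)) * (\<Prod>i\<in>{1..n} - X. cscale t (lin_form (u i))))"
    unfolding lin_prod_def lin_form_add lin_form_cscale by (rule prod_add) simp
  then show ?thesis
    by (simp add: prod_cscale lin_prod_def cscale_mult_right)
qed

text \<open>The coordinate rows of the perturbed vectors form W + t 1, whose determinant is the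
  characteristic polynomial of -W at t. It is monic, so it has finitely many roots. Matrix indices
  start at 0 and variables at 1, hence the \<open>Suc\<close>.\<close>

lemma finite_degenerate_perturbations:
  assumes w: "\<And>i. i \<in> {1..n} \<Longrightarrow> w i \<in> base_space n"
  shows "finite {t. \<exists>i\<in>{1..n}. basis_vec i \<notin> cvs.span ((\<lambda>j. w j + cscale t (basis_vec j)) ` {1..n})}"
proof -
  define M where "M = mat n n (\<lambda>(i, j). - Poly_Mapping.lookup (w (Suc i)) (Suc j))"
  have M: "M \<in> carrier_mat n n" by (simp add: M_def)
  have "char_poly M \<noteq> 0" using degree_monic_char_poly[OF M] by auto
  moreover have "poly (char_poly M) t = 0"
    if i: "i \<in> {1..n}" and ni: "basis_vec i \<notin> cvs.span ((\<lambda>j. w j + cscale t (basis_vec j)) ` {1..n})" for t i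
  proof (rule ccontr)
    assume nz: "poly (char_poly M) t \<noteq> 0"
    define N where "N = - char_matrix M t"
    have N: "N \<in> carrier_mat n n" using M by (simp add: N_def)
    have "det N \<noteq> 0" using nz char_poly_matrix[OF M] by (simp add: N_def)
    \<comment> \<open>Row \<open>i'\<close> of the left inverse contains the coefficients that
      express \<open>basis_vec i\<close> by the perturbed vectors.\<close>
    then obtain H where H: "H \<in> carrier_mat n n" "H * N = 1\<^sub>m n"
      using det_non_zero_imp_unit[OF N] by (auto simp: Units_def ring_mat_def)
    have N_entry: "N $$ (j, l) = Poly_Mapping.lookup (w (Suc j)) (Suc l) + t * (if j = l then 1 else 0)"
      if "j < n" "l < n" for j l
      using that by (auto simp: N_def char_matrix_def M_def)
    obtain i' where i': "i = Suc i'" "i' < n" using i by (cases i) auto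
    have "basis_vec i = (\<Sum>j\<in>{0..<n}. cscale (H $$ (i', j)) (w (Suc j) + cscale t (basis_vec (Suc j))))"
    proof (rule poly_mapping_eqI)
      fix m
      show "Poly_Mapping.lookup (basis_vec i) m = Poly_Mapping.lookup
          (\<Sum>j\<in>{0..<n}. cscale (H $$ (i', j)) (w (Suc j) + cscale t (basis_vec (Suc j)))) m"
      proof (cases "m \<in> {1..n}")
        case True
        then obtain l where l: "m = Suc l" "l < n" by (cases m) auto
        have "(\<Sum>j\<in>{0..<n}. H $$ (i', j) * N $$ (j, l)) = (H * N) $$ (i', l)"
          using H(1) N i' l by (auto simp: scalar_prod_def)
        also have "\<dots> = (if i' = l then 1 else 0)" using H(2) i' l by simp
        finally show ?thesis
          using i' l N_entry
          by (simp add: lookup_sum lookup_add basis_vec_def lookup_single when_def cong: if_cong)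
      next
        case False
        have "Poly_Mapping.lookup (w (Suc j)) m = 0" if "j < n" for j
          using w[of "Suc j"] that False by (auto simp: base_space_def in_keys_iff subset_iff)
        then show ?thesis
          using False i by (auto simp: lookup_sum lookup_add basis_vec_def lookup_single when_def)
      qed
    qed
    also have "\<dots> \<in> cvs.span ((\<lambda>j. w j + cscale t (basis_vec j)) ` {1..n})"
      by (intro cvs.span_sum cvs.span_scale cvs.span_base imageI) auto
    finally show False using ni by simp
  qed
  then have "{t. \<exists>i\<in>{1..n}. basis_vec i \<notin> cvs.span ((\<lambda>j. w j + cscale t (basis_vec j)) ` {1..n})}
      \<subseteq> {t. poly (char_poly M) t = 0}" by blast
  ultimately show ?thesis using poly_roots_finite finite_subset by blast
qed

lemma koszul_minor_chow_zero:
  assumes kp: "k < d" "p < d"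
    and w: "\<And>i. i \<in> {1..d} \<Longrightarrow> w i \<in> base_space d"
    and C: "is_basis_of C (koszul_cod d d k p)"
    and bs: "set bs \<subseteq> koszul_dom d k p" "length bs = S_rank p d k + 1"
    and cs: "length cs = S_rank p d k + 1"
  shows "koszul_minor C bs cs (lin_prod w {1..d}) = 0"
proof -
  let ?w = "\<lambda>t j. w j + cscale t (basis_vec j)"
  \<comment> \<open>The curve is indexed by subsets and not by exponents, so several
    \<open>q X\<close> may belong to one power of t.\<close>
  define q where "q X = lin_prod w X * lin_prod basis_vec ({1..d} - X)" for X
  have "q X \<in> sym_power d d" if X: "X \<in> Pow {1..d}" for X
  proof -
    have fin: "finite X" using X by (auto intro: finite_subset)
    have "card X \<le> d" using X card_mono[of "{1..d}" X] by auto
    then have "card X + card ({1..d} - X) = d"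
      using X fin by (simp add: card_Diff_subset)
    moreover have "q X \<in> sym_power d (card X + card ({1..d} - X))"
      unfolding q_def using X fin w
      by (intro sym_power_mult lin_prod_mem_sym_power) (auto intro: basis_vec_mem_base_space)
    ultimately show ?thesis by simp
  qed
  moreover have "cvs.subspace (sym_power d d)" unfolding sym_power_span by (rule cvs.subspace_span)
  moreover have "poly_fun (sym_power d d) (koszul_minor C bs cs)"
    using C bs cs by (intro poly_fun_koszul_minor) auto
  ultimately obtain g where g: "\<And>t. koszul_minor C bs cs (lin_prod (?w t) {1..d}) = poly g t"
    unfolding lin_prod_perturb
    using poly_fun_curve[of "sym_power d d" "koszul_minor C bs cs" "Pow {1..d}" q
        "\<lambda>X. card ({1..d} - X)"] by (auto simp: q_def)
  define Z where "Z = {t. \<exists>i\<in>{1..d}. basis_vec i \<notin> cvs.span (?w t ` {1..d})}"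
  have "finite Z" unfolding Z_def using w by (rule finite_degenerate_perturbations)
  have "poly g t = 0" if "t \<notin> Z" for t
    unfolding g[symmetric]
  proof (rule koszul_minor_lin_prod_zero[OF kp _ _ C bs cs])
    fix i assume i: "i \<in> {1..d}"
    show "basis_vec i \<in> cvs.span (?w t ` {1..d})" using that i by (auto simp: Z_def)
    have "w i \<in> base_space d" "basis_vec i \<in> base_space d"
      using w i basis_vec_mem_base_space by auto
    then show "?w t i \<in> base_space d"
      unfolding base_space_span by (intro cvs.span_add cvs.span_scale)
  qed
  then have "- Z \<subseteq> {t. poly g t = 0}" by auto
  moreover have "infinite (- Z)"
    using \<open>finite Z\<close> infinite_UNIV_char_0 by (metis finite_compl)
  ultimately have "g = 0" using poly_roots_finite finite_subset by blast
  then show ?thesis using g[of 0] by simp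
qed

theorem theorem1p3:
  fixes d k p :: nat
  assumes "1 \<le> k" and "k < d" and "1 \<le> p" and "p < d"
  shows "rank_on (koszul_dom d k p) (koszul_flattening (\<Prod>i=1..d. lin_form (basis_vec i)))
           = S_rank p d k \<and>
         real (S_rank p d k) =
           fact d / (fact p * fact (d - p - 1)) *
           (\<Sum>s = max 0 (p - k)..min p (d - k - 1).
              real (p choose s) * real ((d - 1 - p) choose (s + k - p)) / real (d - k + p - 2 * s)) \<and>
         (6 \<le> d \<and> \<lceil>real d / 2\<rceil> \<le> int k \<and> k \<le> d - 3 \<longrightarrow>
           (\<forall>B C bs cs.
              is_basis_of B (koszul_dom d k p) \<and> is_basis_of C (koszul_cod d d k p) \<and>
              set bs \<subseteq> B \<and> distinct bs \<and> length bs = S_rank p d k + 1 \<and>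
              set cs \<subseteq> C \<and> distinct cs \<and> length cs = S_rank p d k + 1 \<longrightarrow>
              koszul_minor C bs cs \<in> ideal_of (sym_power d d) (chow_variety d d)))"
proof (intro conjI impI allI)
  show "rank_on (koszul_dom d k p) (koszul_flattening (\<Prod>i=1..d. lin_form (basis_vec i)))
           = S_rank p d k"
    using rank_koszul_flattening[OF assms(2,4)] by (simp add: lin_prod_def)
  show "real (S_rank p d k) =
           fact d / (fact p * fact (d - p - 1)) *
           (\<Sum>s = max 0 (p - k)..min p (d - k - 1).
              real (p choose s) * real ((d - 1 - p) choose (s + k - p)) / real (d - k + p - 2 * s))"
    by (rule S_rank_eq[OF assms(2,4)])
  fix B C bs cs
  assume "is_basis_of B (koszul_dom d k p) \<and> is_basis_of C (koszul_cod d d k p) \<and>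
              set bs \<subseteq> B \<and> distinct bs \<and> length bs = S_rank p d k + 1 \<and>
              set cs \<subseteq> C \<and> distinct cs \<and> length cs = S_rank p d k + 1"
  then have C: "is_basis_of C (koszul_cod d d k p)" and bs: "set bs \<subseteq> koszul_dom d k p"
    and len: "length bs = S_rank p d k + 1" "length cs = S_rank p d k + 1"
    using cvs.span_superset[of B] by (auto simp: is_basis_of_def)
  have "koszul_minor C bs cs z = 0" if "L \<in> chow_variety d d" "z \<in> L - {0}" for L z
  proof -
    from that obtain w c where w: "\<forall>i\<in>{1..d}. w i \<in> base_space d"
      and z: "z = cscale c (\<Prod>i=1..d. lin_form (w i))"
      by (auto simp: chow_variety_def projectivize_def cvs.span_singleton)
    \<comment> \<open>A point of the line is a scalar multiple of a product; the scalar is absorbed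
      into the first factor, which exists since d > 0.\<close>
    define w' where "w' = w(1 := cscale c (w 1))"
    have split: "{1..d} = insert 1 {2..d}" using assms by auto
    have "(\<Prod>i\<in>{2..d}. lin_form (w' i)) = (\<Prod>i\<in>{2..d}. lin_form (w i))"
      by (rule prod.cong) (auto simp: w'_def)
    then have "z = lin_prod w' {1..d}"
      unfolding z lin_prod_def split by (simp add: w'_def lin_form_cscale cscale_mult_left)
    moreover have "w' i \<in> base_space d" if "i \<in> {1..d}" for i
      using w that assms unfolding w'_def base_space_span by (auto intro: cvs.span_scale)
    ultimately show ?thesis
      using koszul_minor_chow_zero[OF assms(2,4) _ C bs len] by simp
  qed
  moreover have "poly_fun (sym_power d d) (koszul_minor C bs cs)"
    using C bs len by (intro poly_fun_koszul_minor) auto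
  ultimately show "koszul_minor C bs cs \<in> ideal_of (sym_power d d) (chow_variety d d)"
    by (simp add: ideal_of_def)
qed

end
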